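(* There exist a one-parameter family of strictly convex compact sets $\bar\gamma_\alpha\subset\mathbb{R}^2$ (indexed by $\alpha$ in a nonempty open interval $I\subset\mathbb{R}$, pairwise distinct) with non-smooth boundary curves $\gamma_\alpha$, and values $S_\alpha>\mathrm{Length}(\gamma_\alpha)$ of the string parameter, such that for every $\alpha\in I$ the curve $\Gamma_\alpha$ obtained from $\bar\gamma_\alpha$ by the string construction with parameter $S_\alpha$ is $C^2$-smooth.
   Context: String construction: given a compact convex set $\bar\gamma\subset\mathbb{R}^2$ bounded by a simple closed curve $\gamma$, and a number $S>\mathrm{Length}(\gamma)$ (the string parameter), the curve $\Gamma$ obtained by the string construction is the set of all points $P\in\mathbb{R}^2$ such that the boundary of the cap-body $\mathrm{Conv}(\{P\}\cup\bar\gamma)$ has length $S$. (It is known that $\Gamma$ is always a $C^1$-smooth convex closed curve and that $\gamma$ is a billiard caustic for $\Gamma$.) "Non-smooth" for $\gamma$ means that $\gamma$ is not a $C^1$ curve (it has corner points). "$C^2$-smooth" for $\Gamma$ means that $\Gamma$ is a $C^2$ embedded closed curve (a one-dimensional $C^2$ submanifold of $\mathbb{R}^2$). "Strictly convex" means that the boundary contains no nondegenerate line segment. *)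

theory Defs
  imports "HOL-Analysis.Analysis"
begin

definition path_length :: "(real \<Rightarrow> 'a::metric_space) \<Rightarrow> ereal" where
  "path_length g =
     (SUP (n, t) \<in> {(n::nat, t :: nat \<Rightarrow> real). mono_on {..n} t \<and> t ` {..n} \<subseteq> {0..1}}.
        ereal (\<Sum>i<n. dist (g (t i)) (g (t (Suc i)))))"

(* The set C is a simple closed curve of finite length L.  The length of a simple closed curve
   is the same for all its simple closed parametrizations, so L is determined by C. *)
definition simple_closed_curve_length :: "'a::metric_space set \<Rightarrow> real \<Rightarrow> bool" where
  "simple_closed_curve_length C L \<longleftrightarrow>
     (\<exists>g. simple_path g \<and> pathfinish g = pathstart g \<and> path_image g = C \<and>
          path_length g = ereal L)"

definition string_construction :: "(real^2) set \<Rightarrow> real \<Rightarrow> (real^2) set" where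
  "string_construction K S =
     {P. simple_closed_curve_length (frontier (convex hull ({P} \<union> K))) S}"

definition strictly_convex :: "'a::real_normed_vector set \<Rightarrow> bool" where
  "strictly_convex K \<longleftrightarrow>
     convex K \<and> (\<forall>a b. closed_segment a b \<subseteq> frontier K \<longrightarrow> a = b)"

definition Ck_map :: "nat \<Rightarrow> (real \<Rightarrow> 'a::real_normed_vector) \<Rightarrow> bool" where
  "Ck_map k c \<longleftrightarrow>
     (\<exists>D. D 0 = c \<and>
          (\<forall>j<k. \<forall>t. (D j has_vector_derivative D (Suc j) t) (at t)) \<and>
          (\<forall>j\<le>k. continuous_on UNIV (D j)))"

(* C is the image of a C^k embedding of the circle R/Z: an injective C^k immersion of the compact
   circle is an embedding, so for k \<ge> 1 these are the compact connected one-dimensional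
   C^k submanifolds. *)
definition Ck_closed_curve :: "nat \<Rightarrow> 'a::real_normed_vector set \<Rightarrow> bool" where
  "Ck_closed_curve k C \<longleftrightarrow>
     (\<exists>c. Ck_map k c \<and> (\<forall>t. c (t + 1) = c t) \<and> inj_on c {0..<1} \<and>
          (\<forall>t. vector_derivative c (at t) \<noteq> 0) \<and> range c = C)"

end

theory Submission
  imports Defs
begin

text \<open>
  Every strictly convex compact set with interior points yields a \<open>C\<^sup>2\<close> curve for a long enough
  string, and lenses (intersections of two unit discs) are strictly convex with two corners.

  By the Cauchy-Crofton formula the boundary length of a planar convex body is the integral of its
  support function, up to a constant. The support function of the cap body of \<open>K\<close> and \<open>P\<close> is the
  maximum of the support function \<open>h\<close> of \<open>K\<close> and of the linear function given by \<open>P\<close>, so the string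
  curve is a level set of a convex function of \<open>P\<close>, whose gradient at \<open>P\<close> depends only on the two
  tangent directions from \<open>P\<close> to \<open>K\<close>. Strict convexity of \<open>K\<close> makes \<open>h\<close> continuously
  differentiable, hence the tangent directions are \<open>C\<^sup>1\<close> functions of the polar angle and the polar
  radius of the curve is \<open>C\<^sup>2\<close>.
\<close>

section \<open>Unit directions in the plane\<close>

text \<open>Corners of \<open>K\<close> cost nothing because smoothness is asked of \<open>h\<close>
  and not of the boundary: a corner \<open>p\<close> only produces an arc of directions on which
  \<open>h \<theta>\<close> is \<open>p \<bullet> dirv \<theta>\<close>. The obstacle is a circular
  dependence: the tangent directions vary smoothly only if the point does, while the motion of the
  point is governed by the tangent directions. Convexity breaks it. The subgradient inequalities at
  two points of the curve bound an increment of the radius from both sides; this makes the radius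
  Lipschitz before anything is known about tangents, which yields continuous tangent directions. A
  squeeze between the same bounds gives the first derivative of the radius, and implicit
  differentiation of the tangency equation gives that of the tangent directions, hence the second
  derivative of the radius. Nothing is differentiated under the integral sign. The long string
  provides transversality: if \<open>M\<close> bounds \<open>h\<close> and its derivative, a point
  farther than \<open>2 * M\<close> from the origin has tangent normals 60 to 90 degrees off its own
  direction, where the tangency equation has nonzero derivative.\<close>

definition dirv :: "real \<Rightarrow> real^2" where
  "dirv \<theta> = vector [cos \<theta>, sin \<theta>]"

lemma dirv_nth [simp]: "dirv \<theta> $ 1 = cos \<theta>" "dirv \<theta> $ 2 = sin \<theta>"
  by (simp_all add: dirv_def)

lemma inner_real2: "x \<bullet> y = x $ 1 * y $ 1 + x $ 2 * y $ 2" for x y :: "real^2"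
  by (simp add: inner_vec_def sum_2)

lemma inner_dirv_dirv: "dirv a \<bullet> dirv b = cos (a - b)"
  by (simp add: inner_real2 cos_diff)

lemma norm_dirv [simp]: "norm (dirv a) = 1"
  by (simp add: norm_eq_sqrt_inner inner_dirv_dirv)

lemma dirv_periodic [simp]: "dirv (a + 2 * pi) = dirv a"
  by (simp add: dirv_def)

lemma dirv_plus_pi: "dirv (a + pi) = - dirv a"
  by (simp add: vec_eq_iff forall_2)

lemma has_vector_derivative_vec2:
  fixes f :: "real \<Rightarrow> real^2"
  assumes "((\<lambda>x. f x $ 1) has_real_derivative d $ 1) (at x)"
    and "((\<lambda>x. f x $ 2) has_real_derivative d $ 2) (at x)"
  shows "(f has_vector_derivative d) (at x)"
proof -
  have "((\<lambda>x. f x $ i) has_vector_derivative d $ i) (at x)" for i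
    using assms exhaust_2[of i] by (auto simp: has_real_derivative_iff_has_vector_derivative)
  then have "((\<lambda>x. f x \<bullet> b) has_vector_derivative d \<bullet> b) (at x)" if "b \<in> Basis" for b
    using that by (auto simp: Basis_vec_def inner_axis)
  then show ?thesis
    unfolding has_vector_derivative_def
    by (subst has_derivative_componentwise_within) auto
qed

lemma has_vector_derivative_dirv:
  "(dirv has_vector_derivative dirv (x + pi / 2)) (at x within A)"
proof -
  have "(dirv has_vector_derivative dirv (x + pi / 2)) (at x)"
    by (rule has_vector_derivative_vec2) (auto simp: cos_add sin_add intro!: derivative_eq_intros)
  then show ?thesis
    by (rule has_vector_derivative_at_within)
qed

lemma continuous_on_dirv [continuous_intros]:
  "continuous_on A f \<Longrightarrow> continuous_on A (\<lambda>x. dirv (f x))"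
proof -
  have "continuous_on UNIV dirv"
    using has_vector_derivative_dirv by (meson continuous_at_imp_continuous_on has_vector_derivative_continuous)
  then show "continuous_on A f \<Longrightarrow> continuous_on A (\<lambda>x. dirv (f x))"
    using continuous_on_compose2 by blast
qed

lemma polar_real2:
  fixes P :: "real^2"
  obtains t where "0 \<le> t" "t < 1" "P = norm P *\<^sub>R dirv (2 * pi * t)"
proof (cases "P = 0")
  case True
  then show ?thesis using that[of 0] by simp
next
  case False
  have n: "(norm P)\<^sup>2 = (P $ 1)\<^sup>2 + (P $ 2)\<^sup>2"
    unfolding power2_norm_eq_inner by (simp add: inner_real2 power2_eq_square)
  have "(P $ 1 / norm P)\<^sup>2 + (P $ 2 / norm P)\<^sup>2 = 1"
    using False by (simp add: power_divide n[symmetric] add_divide_distrib[symmetric])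
  then obtain s where s: "0 \<le> s" "s < 2 * pi" "P $ 1 / norm P = cos s" "P $ 2 / norm P = sin s"
    by (rule sincos_total_2pi)
  show ?thesis
  proof (rule that[of "s / (2 * pi)"])
    show "P = norm P *\<^sub>R dirv (2 * pi * (s / (2 * pi)))"
      using False by (simp add: vec_eq_iff forall_2 s(3,4)[symmetric])
  qed (use s(1,2) in \<open>auto simp: divide_simps\<close>)
qed

lemma dirv_eq_iff: "dirv (2 * pi * s) = dirv (2 * pi * t) \<longleftrightarrow> (\<exists>k::int. s = t + k)"
proof -
  have "dirv (2 * pi * s) = dirv (2 * pi * t) \<longleftrightarrow>
      sin (2 * pi * s) = sin (2 * pi * t) \<and> cos (2 * pi * s) = cos (2 * pi * t)"
    by (auto simp: vec_eq_iff forall_2)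
  also have "\<dots> \<longleftrightarrow> (\<exists>k::int. 2 * pi * s = 2 * pi * t + 2 * pi * k)"
    unfolding sin_cos_eq_iff by (metis mult.assoc mult.commute)
  also have "\<dots> \<longleftrightarrow> (\<exists>k::int. s = t + k)"
    by (simp flip: distrib_left)
  finally show ?thesis .
qed

lemma int_shift_unit:
  assumes "s = t + real_of_int k" "0 \<le> s" "s < 1" "0 \<le> t" "t < 1"
  shows "s = t"
proof -
  have "-1 < real_of_int k" "real_of_int k < 1" using assms by auto
  then have "k = 0" by linarith
  then show ?thesis using assms by simp
qed

section \<open>Simple closed parametrizations of the circle and of convex frontiers\<close>

lemma inj_on_dirv_unit: "inj_on (\<lambda>t. dirv (2 * pi * t)) {0..<1}"
  by (rule inj_onI) (auto simp: dirv_eq_iff intro: int_shift_unit)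

lemma simple_closed_unit_circle:
  "simple_path (\<lambda>t. dirv (2 * pi * t))" "path_image (\<lambda>t. dirv (2 * pi * t)) = sphere 0 1"
proof -
  have lf: "s = t \<or> s = 0 \<and> t = 1 \<or> s = 1 \<and> t = 0"
    if "0 \<le> s" "s \<le> 1" "0 \<le> t" "t \<le> 1" "dirv (2 * pi * s) = dirv (2 * pi * t)" for s t
  proof -
    have 0: "dirv (2 * pi * 1) = dirv (2 * pi * 0)"
      using dirv_periodic[of 0] by simp
    \<comment> \<open>\<open>?r\<close> folds the endpoint 1 onto 0, which reduces the claim to
      injectivity on the half-open interval.\<close>
    let ?r = "\<lambda>t. if t = 1 then 0 else (t::real)"
    have "dirv (2 * pi * ?r s) = dirv (2 * pi * ?r t)"
      using that 0 by auto
    then have "?r s = ?r t"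
      using inj_on_dirv_unit that by (auto dest!: inj_onD)
    then show ?thesis by (auto split: if_splits)
  qed
  have "path (\<lambda>t. dirv (2 * pi * t))"
    unfolding path_def by (intro continuous_intros)
  moreover have "loop_free (\<lambda>t. dirv (2 * pi * t))"
    unfolding loop_free_def using lf by (metis atLeastAtMost_iff)
  ultimately show "simple_path (\<lambda>t. dirv (2 * pi * t))"
    by (simp add: simple_path_def)
  show "path_image (\<lambda>t. dirv (2 * pi * t)) = sphere 0 1"
  proof
    show "path_image (\<lambda>t. dirv (2 * pi * t)) \<subseteq> sphere 0 1"
      by (auto simp: path_image_def)
    show "sphere 0 1 \<subseteq> path_image (\<lambda>t. dirv (2 * pi * t))"
    proof
      fix P :: "real^2" assume "P \<in> sphere 0 1"
      moreover obtain t where "0 \<le> t" "t < 1" "P = norm P *\<^sub>R dirv (2 * pi * t)"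
        by (rule polar_real2)
      ultimately have "t \<in> {0..1}" "P = dirv (2 * pi * t)" by auto
      then show "P \<in> path_image (\<lambda>t. dirv (2 * pi * t))"
        unfolding path_image_def by blast
    qed
  qed
qed

text \<open>Comparison with the unit disc makes the frontier a topological circle. Only the
  existence of a parametrization is drawn from this; lengths are computed for every parametrization
  at once in \<open>path_length_eq_perimeter\<close>.\<close>

lemma ex_simple_closed_frontier:
  fixes C :: "(real^2) set"
  assumes "compact C" "convex C" "interior C \<noteq> {}"
  obtains g where "simple_path g" "pathfinish g = pathstart g" "path_image g = frontier C"
proof -
  have i: "interior (cball (0::real^2) 1) \<noteq> {}" by simp
  have "rel_frontier (cball (0::real^2) 1) homeomorphic rel_frontier C"
    using assms i by (intro homeomorphic_rel_frontiers_convex_bounded_sets)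
      (auto simp: compact_imp_bounded aff_dim_nonempty_interior simp del: interior_cball)
  then have "sphere (0::real^2) 1 homeomorphic frontier C"
    using assms i by (simp add: rel_frontier_nonempty_interior)
  then obtain f f' where f: "homeomorphism (sphere (0::real^2) 1) (frontier C) f f'"
    by (auto simp: homeomorphic_def)
  let ?c = "\<lambda>t. dirv (2 * pi * t)"
  show ?thesis
  proof (rule that[of "f \<circ> ?c"])
    show "simple_path (f \<circ> ?c)"
      using f by (intro simple_path_continuous_image)
        (auto simp: simple_closed_unit_circle homeomorphism_def intro: inj_on_inverseI)
    show "pathfinish (f \<circ> ?c) = pathstart (f \<circ> ?c)"
      using dirv_periodic[of 0] by (simp add: pathfinish_def pathstart_def)
    show "path_image (f \<circ> ?c) = frontier C"
      using f by (simp add: path_image_compose simple_closed_unit_circle homeomorphism_def)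
  qed
qed

text \<open>In terms of an antiderivative \<open>F\<close> the integral is
  \<open>F (a + p) - F a\<close>, whose derivative in \<open>a\<close> vanishes by
  periodicity.\<close>

lemma integral_period_shift:
  fixes f :: "real \<Rightarrow> real"
  assumes cont: "continuous_on UNIV f" and per: "\<And>x. f (x + p) = f x" and "0 < p"
  shows "integral {a..a + p} f = integral {0..p} f"
proof -
  obtain F where F: "\<And>x. (F has_vector_derivative f x) (at x)"
    using einterval_antiderivative[of "-\<infinity>" "\<infinity>" f] cont
    by (auto simp: continuous_on_eq_continuous_at)
  have FTC: "integral {a..a + p} f = F (a + p) - F a" for a
    using F \<open>0 < p\<close>
    by (intro integral_unique fundamental_theorem_of_calculus)
      (auto intro: has_vector_derivative_at_within)
  have "((\<lambda>a. F (a + p) - F a) has_real_derivative 0) (at a)" for a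
  proof -
    have "((\<lambda>a. F (a + p)) has_real_derivative f (a + p)) (at a)"
      using F[of "a + p"] DERIV_shift[of F "f (a + p)" a p]
      unfolding has_real_derivative_iff_has_vector_derivative by blast
    then show ?thesis
      using DERIV_diff[of "\<lambda>a. F (a + p)" "f (a + p)" a UNIV F "f a"] F[of a] per[of a]
      by (simp add: has_real_derivative_iff_has_vector_derivative)
  qed
  then have const: "\<forall>a. ((\<lambda>a. F (a + p) - F a) has_real_derivative 0) (at a)" by blast
  have "F (a + p) - F a = F (0 + p) - F 0"
    by (rule DERIV_isconst_all[OF const])
  then have "integral {a..a + p} f = integral {0..0 + p} f"
    by (simp only: FTC)
  then show ?thesis
    by simp
qed

section \<open>Support functions and Crofton's formula\<close>

text \<open>Taking the angle of the normal as argument, and not a unit vector, gives a periodic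
  function of one real variable.\<close>

definition supp :: "(real^2) set \<Rightarrow> real \<Rightarrow> real" where
  "supp C \<theta> = (SUP x\<in>C. x \<bullet> dirv \<theta>)"

lemma bdd_above_supp: "compact C \<Longrightarrow> bdd_above ((\<lambda>x. x \<bullet> dirv \<theta>) ` C)"
  by (intro bounded_imp_bdd_above compact_imp_bounded compact_continuous_image continuous_intros)

lemma supp_ge: "compact C \<Longrightarrow> x \<in> C \<Longrightarrow> x \<bullet> dirv \<theta> \<le> supp C \<theta>"
  unfolding supp_def by (rule cSUP_upper[OF _ bdd_above_supp])

lemma supp_le: "C \<noteq> {} \<Longrightarrow> (\<And>x. x \<in> C \<Longrightarrow> x \<bullet> dirv \<theta> \<le> b) \<Longrightarrow> supp C \<theta> \<le> b"
  unfolding supp_def by (rule cSUP_least)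

lemma supp_attained:
  assumes "compact C" "C \<noteq> {}"
  obtains x where "x \<in> C" "x \<bullet> dirv \<theta> = supp C \<theta>"
proof -
  have "\<exists>x\<in>C. \<forall>y\<in>C. y \<bullet> dirv \<theta> \<le> x \<bullet> dirv \<theta>"
    using assms by (intro continuous_attains_sup continuous_intros)
  then obtain x where "x \<in> C" "\<forall>y\<in>C. y \<bullet> dirv \<theta> \<le> x \<bullet> dirv \<theta>" by blast
  then show ?thesis
    using that[of x] supp_ge[OF assms(1), of x] supp_le[OF assms(2)] by (meson order_antisym)
qed

lemma supp_periodic: "supp C (\<theta> + 2 * pi) = supp C \<theta>"
  by (simp add: supp_def)

text \<open>Together with \<open>supp_ge\<close> this places the projection of \<open>C\<close>
  between \<open>- supp C (\<theta> + pi)\<close> and \<open>supp C \<theta>\<close>, an interval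
  whose length is the width of \<open>C\<close>.\<close>

lemma supp_plus_pi_ge: "compact C \<Longrightarrow> x \<in> C \<Longrightarrow> - supp C (\<theta> + pi) \<le> x \<bullet> dirv \<theta>"
  using supp_ge[of C x "\<theta> + pi"] by (simp add: dirv_plus_pi)

text \<open>A supremum of functions of \<open>dirv \<theta>\<close> with a common Lipschitz
  constant, namely a bound for the norms of the points of \<open>C\<close>.\<close>

lemma continuous_on_supp:
  assumes "compact C" "C \<noteq> {}"
  shows "continuous_on UNIV (supp C)"
proof -
  obtain M where M: "M > 0" "\<And>x. x \<in> C \<Longrightarrow> norm x \<le> M"
    using assms compact_imp_bounded bounded_pos by metis
  have le: "supp C a \<le> supp C b + M * norm (dirv a - dirv b)" for a b
  proof (rule supp_le[OF assms(2)])
    fix x assume x: "x \<in> C"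
    have "x \<bullet> dirv a = x \<bullet> dirv b + x \<bullet> (dirv a - dirv b)"
      by (simp add: inner_diff_right)
    also have "\<dots> \<le> supp C b + norm x * norm (dirv a - dirv b)"
      using supp_ge[OF assms(1) x] norm_cauchy_schwarz by (rule add_mono)
    also have "\<dots> \<le> supp C b + M * norm (dirv a - dirv b)"
      using M x by (simp add: mult_right_mono)
    finally show "x \<bullet> dirv a \<le> supp C b + M * norm (dirv a - dirv b)" .
  qed
  have "isCont (supp C) b" for b
  proof -
    have "\<bar>supp C a - supp C b\<bar> \<le> M * norm (dirv a - dirv b)" for a
      using le[of a b] le[of b a] by (simp add: norm_minus_commute)
    moreover have "((\<lambda>a. M * norm (dirv a - dirv b)) \<longlongrightarrow> M * norm (dirv b - dirv b)) (at b)"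
      using has_vector_derivative_continuous[OF has_vector_derivative_dirv, of b UNIV]
      by (intro tendsto_intros) (simp add: continuous_within)
    ultimately have "((\<lambda>a. supp C a - supp C b) \<longlongrightarrow> 0) (at b)"
      using Lim_null_comparison[of "\<lambda>a. supp C a - supp C b" "\<lambda>a. M * norm (dirv a - dirv b)" "at b"]
      by simp
    then show ?thesis
      by (simp add: isCont_def LIM_zero_iff)
  qed
  then show ?thesis
    by (simp add: continuous_on_eq_continuous_at)
qed

text \<open>The Cauchy-Crofton constant, numerically 4. It is kept symbolic;
  \<open>crofton_pos\<close> allows dividing by it.\<close>

definition crofton :: real where
  "crofton = integral {0..2 * pi} (\<lambda>\<theta>. \<bar>cos \<theta>\<bar>)"

lemma crofton_pos: "0 < crofton"
proof -
  have "crofton \<noteq> 0"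
  proof
    assume "crofton = 0"
    then have "((\<lambda>\<theta>. \<bar>cos \<theta>\<bar>) has_integral 0) (cbox 0 (2 * pi))"
      unfolding crofton_def box_real
      by (rule subst) (intro integrable_integral integrable_continuous_real continuous_intros)
    then have "\<bar>cos 0\<bar> = (0::real)"
      using pi_gt_zero
      by (intro has_integral_0_cbox_imp_0[of 0 "2 * pi" "\<lambda>\<theta>. \<bar>cos \<theta>\<bar>" 0])
        (auto intro!: continuous_intros simp del: pi_gt_zero)
    then show False by simp
  qed
  moreover have "0 \<le> crofton"
    unfolding crofton_def by (intro integral_nonneg integrable_continuous_real continuous_intros) auto
  ultimately show ?thesis by simp
qed

text \<open>Crofton's formula for one segment with edge vector \<open>v\<close>: turning
  \<open>v\<close> onto the first axis shifts \<theta> by a constant, which does not change an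
  integral over a full period.\<close>

lemma integral_abs_inner_dirv:
  "integral {0..2 * pi} (\<lambda>\<theta>. \<bar>v \<bullet> dirv \<theta>\<bar>) = crofton * norm v"
proof -
  obtain t where t: "v = norm v *\<^sub>R dirv (2 * pi * t)" by (rule polar_real2)
  define a where "a = - (2 * pi * t)"
  have "\<bar>v \<bullet> dirv \<theta>\<bar> = norm v * \<bar>cos (\<theta> + a)\<bar>" for \<theta>
    by (subst t) (simp add: abs_mult inner_dirv_dirv a_def cos_diff mult.commute)
  then have "integral {0..2 * pi} (\<lambda>\<theta>. \<bar>v \<bullet> dirv \<theta>\<bar>) = norm v * integral {0..2 * pi} (\<lambda>\<theta>. \<bar>cos (\<theta> + a)\<bar>)"
    by simp
  also have "integral {0..2 * pi} (\<lambda>\<theta>. \<bar>cos (\<theta> + a)\<bar>) = integral {a..a + 2 * pi} (\<lambda>\<theta>. \<bar>cos \<theta>\<bar>)"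
  proof -
    have "continuous_on {0 + a..2 * pi + a} (\<lambda>\<theta>. \<bar>cos \<theta>\<bar>)"
      by (intro continuous_intros)
    from integral_shift[OF this] show ?thesis
      by (simp add: o_def add.commute)
  qed
  also have "\<dots> = crofton"
    unfolding crofton_def by (rule integral_period_shift) (auto intro!: continuous_intros)
  finally show ?thesis by (simp add: mult.commute)
qed

(* Each increment is the measure of the levels it crosses, and a level is crossed at most twice. *)
lemma variation_le_two_hits:
  fixes f t :: "_ \<Rightarrow> real"
  assumes cont: "continuous_on {0..1} f" and im: "\<And>s. s \<in> {0..1} \<Longrightarrow> a \<le> f s \<and> f s \<le> b"
    and hits: "\<And>c. a < c \<Longrightarrow> c < b \<Longrightarrow>
      finite {s \<in> {0..<1}. f s = c} \<and> card {s \<in> {0..<1}. f s = c} \<le> 2"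
    and t: "mono_on {..n} t" "t ` {..n} \<subseteq> {0..1}"
  shows "(\<Sum>i<n. \<bar>f (t (Suc i)) - f (t i)\<bar>) \<le> 2 * (b - a)"
proof -
  define l where "l i = min (f (t i)) (f (t (Suc i)))" for i
  define u where "u i = max (f (t i)) (f (t (Suc i)))" for i
  have t01: "0 \<le> t i" "t i \<le> 1" if "i \<le> n" for i
    using t(2) that by auto
  have tmono: "t i \<le> t j" if "i \<le> j" "j \<le> n" for i j
    using t(1) that by (auto simp: mono_on_def)
  have ab: "a \<le> b" using im[of 0] by auto
  have lu: "a \<le> l i" "u i \<le> b" "l i \<le> u i" if "i < n" for i
    using im[of "t i"] im[of "t (Suc i)"] t01[of i] t01[of "Suc i"] that
    by (auto simp: l_def u_def)
  have "((\<lambda>c. indicator {l i<..<u i} c) has_integral \<bar>f (t (Suc i)) - f (t i)\<bar>) {a..b}"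
    if "i < n" for i
  proof -
    have "((\<lambda>c. 1::real) has_integral (u i - l i)) {l i..u i}"
      using lu that has_integral_const_real[of "1::real" "l i" "u i"] by simp
    then have "((\<lambda>c. 1::real) has_integral (u i - l i)) {l i<..<u i}"
      by (simp add: has_integral_Icc_iff_Ioo)
    then have "((\<lambda>c. if c \<in> {l i<..<u i} then 1::real else 0) has_integral (u i - l i)) {a..b}"
      using lu that by (subst has_integral_restrict) force+
    moreover have "u i - l i = \<bar>f (t (Suc i)) - f (t i)\<bar>"
      by (auto simp: u_def l_def)
    ultimately show ?thesis
      by (simp add: indicator_def of_bool_def)
  qed
  then have "((\<lambda>c. \<Sum>i<n. indicator {l i<..<u i} c) has_integral
      (\<Sum>i<n. \<bar>f (t (Suc i)) - f (t i)\<bar>)) {a..b}"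
    by (intro has_integral_sum) auto
  moreover have "((\<lambda>c. 2::real) has_integral (2 * (b - a))) {a..b}"
    using ab has_integral_const_real[of "2::real" a b] by (simp add: mult.commute)
  moreover have "(\<Sum>i<n. indicator {l i<..<u i} c) \<le> (2::real)" if "c \<in> {a..b}" for c
  proof -
    define N where "N = {i. i < n \<and> c \<in> {l i<..<u i}}"
    have sum: "(\<Sum>i<n. indicator {l i<..<u i} c) = real (card N)"
      unfolding N_def indicator_def of_bool_def
      by (subst sum.If_cases) (auto intro!: arg_cong[where f = card])
    show ?thesis
    proof (cases "N = {}")
      case True
      then show ?thesis by (simp add: sum)
    next
      case False
      \<comment> \<open>A level crossed by some piece lies strictly between \<open>a\<close> and
        \<open>b\<close>, exactly where \<open>hits\<close> applies.\<close>
      then have c: "a < c" "c < b" using lu by (force simp: N_def)+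
      \<comment> \<open>The level differs from both end values, so the hit lies strictly inside the
        piece. Hits of different pieces are therefore distinct, and none is the parameter 1.\<close>
      have "\<exists>s. t i < s \<and> s < t (Suc i) \<and> f s = c" if "i \<in> N" for i
      proof -
        have i: "i < n" using that by (simp add: N_def)
        have "continuous_on {t i..t (Suc i)} f"
          using t01[of i] t01[of "Suc i"] i by (intro continuous_on_subset[OF cont]) auto
        moreover have "f (t i) \<le> c \<and> c \<le> f (t (Suc i)) \<or> f (t (Suc i)) \<le> c \<and> c \<le> f (t i)"
          using that by (auto simp: N_def l_def u_def)
        ultimately obtain s where s: "t i \<le> s" "s \<le> t (Suc i)" "f s = c"
          using IVT'[of f "t i" c "t (Suc i)"] IVT2'[of f "t (Suc i)" c "t i"]
            tmono[of i "Suc i"] i by fastforce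
        moreover have "f (t i) \<noteq> c" "f (t (Suc i)) \<noteq> c"
          using that by (auto simp: N_def l_def u_def)
        ultimately show ?thesis by (metis order_le_less)
      qed
      then obtain s where s: "\<And>i. i \<in> N \<Longrightarrow> t i < s i \<and> s i < t (Suc i) \<and> f (s i) = c"
        by metis
      have "s i < s j" if "i \<in> N" "j \<in> N" "i < j" for i j
        using s[OF that(1)] s[OF that(2)] tmono[of "Suc i" j] that by (auto simp: N_def)
      then have inj: "inj_on s N"
        by (metis inj_onI linorder_neqE_nat order_less_irrefl)
      have sub: "s ` N \<subseteq> {s \<in> {0..<1}. f s = c}"
      proof (clarify, intro conjI)
        fix i assume i: "i \<in> N"
        then have "i < n" by (simp add: N_def)
        then show "s i \<in> {0..<1}"
          using s[OF i] t01[of i] t01[of "Suc i"] by auto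
        show "f (s i) = c" using s[OF i] by simp
      qed
      have "card N \<le> 2"
        using hits[OF c] card_mono[OF _ sub] card_image[OF inj] by linarith
      then show ?thesis by (simp add: sum)
    qed
  qed
  ultimately show ?thesis
    by (rule has_integral_le)
qed

text \<open>The interior is dense in \<open>C\<close>, so it has points on either side of the level
  line, and it is connected.\<close>

lemma interior_point_at_level:
  assumes C: "compact C" "convex C" "interior C \<noteq> {}"
    and c: "- supp C (\<theta> + pi) < c" "c < supp C \<theta>"
  obtains z where "z \<in> interior C" "z \<bullet> dirv \<theta> = c"
proof -
  have C': "C \<noteq> {}" using C(3) interior_subset by blast
  have cl: "closure (interior C) = C"
    using convex_closure_interior[OF C(2,3)] C(1) by (simp add: compact_imp_closed)
  obtain x where x: "x \<in> C" "x \<bullet> dirv \<theta> = supp C \<theta>" using supp_attained[OF C(1) C'] .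
  obtain y where y: "y \<in> C" "y \<bullet> dirv (\<theta> + pi) = supp C (\<theta> + pi)" using supp_attained[OF C(1) C'] .
  have "x \<in> {p. c < p \<bullet> dirv \<theta>}" using x c by simp
  moreover have "open {p. c < p \<bullet> dirv \<theta>}"
    by (intro open_Collect_less continuous_intros)
  ultimately have "{p. c < p \<bullet> dirv \<theta>} \<inter> interior C \<noteq> {}"
    using x(1) cl open_Int_closure_eq_empty by blast
  then obtain x' where x': "x' \<in> interior C" "c \<le> dirv \<theta> \<bullet> x'"
    by (force simp: inner_commute[of "dirv \<theta>"])
  have "y \<in> {p. p \<bullet> dirv \<theta> < c}" using y c by (simp add: dirv_plus_pi)
  moreover have "open {p. p \<bullet> dirv \<theta> < c}"
    by (intro open_Collect_less continuous_intros)
  ultimately have "{p. p \<bullet> dirv \<theta> < c} \<inter> interior C \<noteq> {}"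
    using y(1) cl open_Int_closure_eq_empty by blast
  then obtain y' where y': "y' \<in> interior C" "dirv \<theta> \<bullet> y' \<le> c"
    by (force simp: inner_commute[of "dirv \<theta>"])
  have "connected (interior C)"
    using C(2) by (intro convex_connected convex_interior)
  then obtain z where "z \<in> interior C" "dirv \<theta> \<bullet> z = c"
    using connected_ivt_hyperplane[OF _ y'(1) x'(1) y'(2) x'(2)] by blast
  then show ?thesis
    using that[of z] by (simp add: inner_commute[of "dirv \<theta>"])
qed

lemma inner_dirv_0_imp:
  assumes "w \<bullet> dirv \<theta> = 0"
  shows "w = (w \<bullet> dirv (\<theta> + pi / 2)) *\<^sub>R dirv (\<theta> + pi / 2)"
proof -
  have "w $ 1 * cos \<theta> + w $ 2 * sin \<theta> = 0"
    using assms by (simp add: inner_real2)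
  moreover have "(sin \<theta>)\<^sup>2 + (cos \<theta>)\<^sup>2 = 1" by simp
  ultimately have "w $ 1 = (w $ 1 * - sin \<theta> + w $ 2 * cos \<theta>) * - sin \<theta>"
    "w $ 2 = (w $ 1 * - sin \<theta> + w $ 2 * cos \<theta>) * cos \<theta>"
    by algebra+
  then show ?thesis
    by (simp add: vec_eq_iff forall_2 inner_real2 cos_add sin_add)
qed

text \<open>Of two frontier points on the same ray from the interior point \<open>z\<close>, the
  nearer one would lie on an open segment from \<open>z\<close> to a point of \<open>C\<close>,
  hence in the interior.\<close>

lemma frontier_same_side_eq:
  fixes p q z :: "real^2"
  assumes C: "compact C" "convex C" and z: "z \<in> interior C"
    and p: "p \<in> frontier C" "p \<bullet> dirv \<theta> = z \<bullet> dirv \<theta>"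
    and q: "q \<in> frontier C" "q \<bullet> dirv \<theta> = z \<bullet> dirv \<theta>"
    and side: "sgn ((p - z) \<bullet> dirv (\<theta> + pi / 2)) = sgn ((q - z) \<bullet> dirv (\<theta> + pi / 2))"
  shows "p = q"
proof -
  let ?e = "dirv (\<theta> + pi / 2)"
  note dec = inner_dirv_0_imp[of _ \<theta>]
  have fr: "w \<in> frontier C \<Longrightarrow> w \<in> C \<and> w \<notin> interior C" for w
    using C(1) by (auto simp: frontier_def compact_imp_closed)
  have aux: False
    if w: "w \<in> frontier C" "w \<bullet> dirv \<theta> = z \<bullet> dirv \<theta>"
      and v: "v \<in> frontier C" "v \<bullet> dirv \<theta> = z \<bullet> dirv \<theta>"
      and sd: "sgn ((w - z) \<bullet> ?e) = sgn ((v - z) \<bullet> ?e)"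
      and less: "\<bar>(w - z) \<bullet> ?e\<bar> < \<bar>(v - z) \<bullet> ?e\<bar>" for w v
  proof -
    define s where "s = (w - z) \<bullet> ?e"
    define r where "r = (v - z) \<bullet> ?e"
    have ws: "w = z + s *\<^sub>R ?e" using dec[of "w - z"] w by (simp add: s_def inner_diff_left algebra_simps)
    have vr: "v = z + r *\<^sub>R ?e" using dec[of "v - z"] v by (simp add: r_def inner_diff_left algebra_simps)
    have "r \<noteq> 0" using less by (auto simp: r_def)
    then have "s \<noteq> 0" using sd by (auto simp: s_def r_def sgn_0_0)
    have u: "0 < s / r" "s / r < 1"
      using sd less \<open>r \<noteq> 0\<close> \<open>s \<noteq> 0\<close> by (auto simp: s_def r_def sgn_if abs_if field_simps zero_less_divide_iff split: if_splits)
    have "w = (1 - s / r) *\<^sub>R z + (s / r) *\<^sub>R v"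
      using \<open>r \<noteq> 0\<close> by (simp add: ws vr algebra_simps)
    moreover have "z \<noteq> v" using z v fr by auto
    ultimately have "w \<in> open_segment z v"
      using u by (auto simp: in_segment)
    then have "w \<in> interior C"
      using in_interior_closure_convex_segment[OF C(2) z, of v] fr[OF v(1)] closure_subset by blast
    then show False using fr w by auto
  qed
  have "\<bar>(p - z) \<bullet> ?e\<bar> = \<bar>(q - z) \<bullet> ?e\<bar>"
    using aux[OF p q side] aux[OF q p side[symmetric]] by (metis linorder_neqE_linordered_idom)
  then have "(p - z) \<bullet> ?e = (q - z) \<bullet> ?e"
    using side by (auto simp: sgn_if abs_if split: if_splits)
  then have "p - z = q - z"
    using dec[of "p - z"] dec[of "q - z"] p q by (metis inner_diff_left right_minus_eq)
  then show ?thesis by simp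
qed

text \<open>The line through an interior point \<open>z\<close> has two sides of \<open>z\<close>,
  and the sign of the offset along it maps the hits injectively into \<open>{-1, 1}\<close>. The
  half-open parameter interval counts the closing point of the path once.\<close>

lemma frontier_path_hits:
  assumes C: "compact C" "convex C" "interior C \<noteq> {}"
    and g: "simple_path g" "path_image g = frontier C"
    and c: "- supp C (\<theta> + pi) < c" "c < supp C \<theta>"
  shows "finite {s \<in> {0..<1}. g s \<bullet> dirv \<theta> = c} \<and> card {s \<in> {0..<1}. g s \<bullet> dirv \<theta> = c} \<le> 2"
proof -
  obtain z where z: "z \<in> interior C" "z \<bullet> dirv \<theta> = c"
    using interior_point_at_level[OF C c] .
  let ?Z = "{s \<in> {0..<1}. g s \<bullet> dirv \<theta> = c}"
  let ?f = "\<lambda>s. sgn ((g s - z) \<bullet> dirv (\<theta> + pi / 2))"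
  have fr: "g s \<in> frontier C" if "s \<in> ?Z" for s
    using that g(2) by (auto simp: path_image_def)
  have inj: "inj_on ?f ?Z"
  proof (rule inj_onI)
    fix s s' assume s: "s \<in> ?Z" "s' \<in> ?Z" "?f s = ?f s'"
    have "g s \<bullet> dirv \<theta> = z \<bullet> dirv \<theta>" "g s' \<bullet> dirv \<theta> = z \<bullet> dirv \<theta>"
      using s z(2) by simp_all
    then have "g s = g s'"
      using frontier_same_side_eq[OF C(1,2) z(1) fr[OF s(1)] _ fr[OF s(2)] _ s(3)] by blast
    moreover have "s \<in> {0..1}" "s' \<in> {0..1}" "s \<noteq> 1" "s' \<noteq> 1"
      using s by auto
    ultimately show "s = s'"
      using g(1) unfolding simple_path_def loop_free_def by blast
  qed
  have "?f s \<noteq> 0" if s: "s \<in> ?Z" for s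
  proof
    assume "?f s = 0"
    then have "g s - z = 0"
      using inner_dirv_0_imp[of "g s - z" \<theta>] s z(2) by (simp add: inner_diff_left sgn_0_0)
    then show False
      using fr[OF s] z(1) by (simp add: frontier_def)
  qed
  moreover have "sgn x \<in> {-1, 1}" if "sgn x \<noteq> 0" for x :: real
    using that by (auto simp: sgn_if)
  ultimately have sub: "?f ` ?Z \<subseteq> {-1, 1}"
    by blast
  have "card {-1, 1::real} = 2" by simp
  then have "card ?Z \<le> 2"
    using card_mono[OF _ sub] card_image[OF inj] by simp
  moreover have "finite ?Z"
    using finite_imageD[OF finite_subset[OF sub] inj] by simp
  ultimately show ?thesis by blast
qed

text \<open>Cauchy's formula. The factor is numerically 1 and is written so as to cancel against
  \<open>crofton_polygon\<close>.\<close>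

definition perimeter :: "(real^2) set \<Rightarrow> real" where
  "perimeter C = 4 / crofton * integral {0..2 * pi} (supp C)"

section \<open>Inscribed polygons and integration over directions\<close>

lemma integral_width:
  assumes "compact C" "C \<noteq> {}"
  shows "integral {0..2 * pi} (\<lambda>\<theta>. supp C \<theta> + supp C (\<theta> + pi)) = 2 * integral {0..2 * pi} (supp C)"
proof -
  note cont = continuous_on_supp[OF assms]
  have "integral {0..2 * pi} (\<lambda>\<theta>. supp C (\<theta> + pi)) = integral {pi..pi + 2 * pi} (supp C)"
    using integral_shift[OF continuous_on_subset[OF cont subset_UNIV], of 0 "2 * pi" pi]
    by (simp add: o_def add.commute)
  also have "\<dots> = integral {0..2 * pi} (supp C)"
    by (rule integral_period_shift[OF cont supp_periodic]) simp
  moreover have "continuous_on {0..2 * pi} (\<lambda>\<theta>. supp C (\<theta> + pi))"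
    by (intro continuous_on_compose2[OF cont] continuous_intros) auto
  ultimately show ?thesis
    using continuous_on_subset[OF cont subset_UNIV, of "{0..2 * pi}"]
    by (subst integral_add) (auto intro: integrable_continuous_real)
qed

lemma crofton_polygon:
  "crofton * (\<Sum>i<n. dist (p i) (p (Suc i))) =
    integral {0..2 * pi} (\<lambda>\<theta>. \<Sum>i<n. \<bar>p (Suc i) \<bullet> dirv \<theta> - p i \<bullet> dirv \<theta>\<bar>)"
proof -
  have "integral {0..2 * pi} (\<lambda>\<theta>. \<Sum>i<n. \<bar>p (Suc i) \<bullet> dirv \<theta> - p i \<bullet> dirv \<theta>\<bar>) =
      (\<Sum>i<n. integral {0..2 * pi} (\<lambda>\<theta>. \<bar>(p (Suc i) - p i) \<bullet> dirv \<theta>\<bar>))"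
    unfolding inner_diff_left
    by (intro integral_sum integrable_continuous_real continuous_intros) auto
  then show ?thesis
    by (simp add: integral_abs_inner_dirv sum_distrib_left dist_norm norm_minus_commute)
qed

text \<open>In each direction the projected path meets a level at most twice, so its variation is at
  most twice the width; integrating over all directions bounds the polygon.\<close>

lemma polygon_le_perimeter:
  assumes C: "compact C" "convex C" "interior C \<noteq> {}"
    and g: "simple_path g" "path_image g = frontier C"
    and t: "mono_on {..n} t" "t ` {..n} \<subseteq> {0..1}"
  shows "(\<Sum>i<n. dist (g (t i)) (g (t (Suc i)))) \<le> perimeter C"
proof -
  have C': "C \<noteq> {}" using C(3) interior_subset by blast
  have gC: "g s \<in> C" if "s \<in> {0..1}" for s
    using that g(2) C(1) by (auto simp: path_image_def frontier_def compact_imp_closed)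
  have contg: "continuous_on {0..1} g"
    using g(1) by (simp add: simple_path_def path_def)
  note cont = continuous_on_supp[OF C(1) C']
  have cont2: "continuous_on {0..2 * pi} (\<lambda>\<theta>. supp C \<theta> + supp C (\<theta> + pi))"
    by (intro continuous_on_compose2[OF cont] continuous_intros) auto
  have "(\<Sum>i<n. \<bar>g (t (Suc i)) \<bullet> dirv \<theta> - g (t i) \<bullet> dirv \<theta>\<bar>) \<le>
      2 * (supp C \<theta> - - supp C (\<theta> + pi))" for \<theta>
    using supp_ge[OF C(1) gC] supp_plus_pi_ge[OF C(1) gC] frontier_path_hits[OF C g]
    by (intro variation_le_two_hits[of "\<lambda>s. g s \<bullet> dirv \<theta>", OF _ _ _ t])
      (auto intro!: continuous_intros contg)
  then have "crofton * (\<Sum>i<n. dist (g (t i)) (g (t (Suc i)))) \<le>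
      integral {0..2 * pi} (\<lambda>\<theta>. 2 * (supp C \<theta> + supp C (\<theta> + pi)))"
    unfolding crofton_polygon[where p = "\<lambda>i. g (t i)"]
    by (intro integral_le integrable_continuous_real continuous_intros cont2) auto
  also have "\<dots> = 4 * integral {0..2 * pi} (supp C)"
    using integral_width[OF C(1) C'] by (simp del: distrib_left_numeral)
  finally show ?thesis
    using crofton_pos by (simp add: perimeter_def field_simps)
qed

lemma abs_diff_le_sum:
  fixes x :: "nat \<Rightarrow> real"
  assumes "i \<le> j"
  shows "\<bar>x j - x i\<bar> \<le> (\<Sum>k\<in>{i..<j}. \<bar>x (Suc k) - x k\<bar>)"
  using assms by (induction j rule: dec_induct) auto

text \<open>A closed sequence travels from one of the two values to the other and has to
  return.\<close>

lemma closed_variation_ge: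
  fixes x :: "nat \<Rightarrow> real"
  assumes "x n = x 0" "i \<le> n" "j \<le> n"
  shows "2 * (x j - x i) \<le> (\<Sum>k<n. \<bar>x (Suc k) - x k\<bar>)"
proof -
  have *: "2 * \<bar>x j - x i\<bar> \<le> (\<Sum>k<n. \<bar>x (Suc k) - x k\<bar>)" if "i \<le> j" "j \<le> n" for i j
  proof -
    have "(\<Sum>k<n. \<bar>x (Suc k) - x k\<bar>) = (\<Sum>k\<in>{0..<i}. \<bar>x (Suc k) - x k\<bar>) +
        (\<Sum>k\<in>{i..<j}. \<bar>x (Suc k) - x k\<bar>) + (\<Sum>k\<in>{j..<n}. \<bar>x (Suc k) - x k\<bar>)"
      using that by (simp add: sum.atLeastLessThan_concat lessThan_atLeast0)
    moreover have "\<bar>x j - x i\<bar> \<le> \<bar>x i - x 0\<bar> + \<bar>x n - x j\<bar>"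
      using assms(1) by linarith
    ultimately show ?thesis
      using abs_diff_le_sum[of 0 i x] abs_diff_le_sum[of i j x] abs_diff_le_sum[of j n x] that
      by simp
  qed
  have "2 * \<bar>x j - x i\<bar> \<le> (\<Sum>k<n. \<bar>x (Suc k) - x k\<bar>)"
    using *[of i j] *[of j i] assms(2,3) abs_minus_commute[of "x i" "x j"]
    by (cases "i \<le> j") (simp_all only: linorder_not_le order_less_imp_le)
  then show ?thesis
    by (rule order_trans[rotated]) (intro mult_left_mono abs_ge_self, simp)
qed

lemma supp_attained_frontier:
  assumes "compact C" "C \<noteq> {}"
  obtains x where "x \<in> frontier C" "x \<bullet> dirv \<theta> = supp C \<theta>"
proof -
  obtain x where x: "x \<in> C" "x \<bullet> dirv \<theta> = supp C \<theta>"
    using supp_attained[OF assms] .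
  have "x \<notin> interior C"
  proof
    assume "x \<in> interior C"
    then obtain e where e: "0 < e" "cball x e \<subseteq> C"
      by (auto simp: mem_interior_cball)
    then have "x + e *\<^sub>R dirv \<theta> \<in> C"
      by (auto simp: dist_norm subset_iff)
    from supp_ge[OF assms(1) this, of \<theta>] show False
      using x e by (simp add: inner_add_left inner_dirv_dirv)
  qed
  then show ?thesis
    using that[of x] x assms by (simp add: frontier_def compact_imp_closed)
qed

text \<open>By uniform continuity one equidistant subdivision brings the vertices within
  \<open>e\<close> of every frontier point, uniformly in the direction. Each projection then loses
  at most \<open>e\<close> at either extreme, so the closed polygon loses at most
  \<open>4 * e\<close> of variation; integration over \<open>2 * pi\<close> gives the error
  \<open>8 * pi * e\<close>.\<close>

lemma ex_polygon_ge_perimeter: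
  assumes C: "compact C" "convex C" "interior C \<noteq> {}"
    and g: "simple_path g" "pathfinish g = pathstart g" "path_image g = frontier C"
    and "0 < e"
  obtains n :: nat and t :: "nat \<Rightarrow> real" where "mono_on {..n} t" "t ` {..n} \<subseteq> {0..1}"
    "perimeter C - 8 * pi * e / crofton \<le> (\<Sum>i<n. dist (g (t i)) (g (t (Suc i))))"
proof -
  have C': "C \<noteq> {}" using C(3) interior_subset by blast
  have "uniformly_continuous_on {0..1} g"
    using g(1) by (simp add: simple_path_def path_def compact_uniformly_continuous)
  then obtain d where d: "d > 0"
    "\<And>s s'. s \<in> {0..1} \<Longrightarrow> s' \<in> {0..1} \<Longrightarrow> dist s' s < d \<Longrightarrow> dist (g s') (g s) < e"
    using \<open>0 < e\<close> unfolding uniformly_continuous_on_def by metis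
  obtain n where n: "inverse (real (Suc n)) < d"
    using reals_Archimedean[OF d(1)] by blast
  define N where "N = Suc n"
  define t where "t i = real i / real N" for i
  have N: "N > 0" "1 / real N < d" using n by (simp_all add: N_def inverse_eq_divide)
  have t1: "mono_on {..N} t" "t ` {..N} \<subseteq> {0..1}"
    using N by (auto simp: mono_on_def t_def divide_simps)
  have near: "\<exists>i\<le>N. dist (g (t i)) (g s) < e" if s: "s \<in> {0..1}" for s
  proof -
    define i where "i = nat \<lfloor>s * real N\<rfloor>"
    have i: "real i \<le> s * real N" "s * real N < real i + 1"
      using s by (auto simp: i_def)
    have "s * real N \<le> real N" using s N by (simp add: mult_left_le_one_le)
    then have "i \<le> N" using i by linarith
    moreover have "t i - s = (real i - s * real N) / real N"
      using N by (simp add: t_def diff_divide_distrib)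
    then have "\<bar>t i - s\<bar> \<le> 1 / real N"
      using i by (simp add: abs_divide divide_right_mono)
    moreover have "t i \<in> {0..1}" using t1(2) \<open>i \<le> N\<close> by blast
    ultimately show ?thesis
      using d(2)[OF s, of "t i"] N by (intro exI[of _ i]) (auto simp: dist_real_def)
  qed
  have nearx: "\<exists>i\<le>N. supp C \<theta> - e \<le> g (t i) \<bullet> dirv \<theta>" for \<theta>
  proof -
    obtain x where x: "x \<in> frontier C" "x \<bullet> dirv \<theta> = supp C \<theta>"
      using supp_attained_frontier[OF C(1) C'] .
    then have "x \<in> g ` {0..1}"
      using g(3) by (simp add: path_image_def)
    then obtain s where s: "s \<in> {0..1}" "g s = x"
      by blast
    then obtain i where i: "i \<le> N" "dist (g (t i)) x < e" using near by blast
    have "(x - g (t i)) \<bullet> dirv \<theta> \<le> norm (x - g (t i)) * norm (dirv \<theta>)"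
      by (rule norm_cauchy_schwarz)
    then have "supp C \<theta> - e \<le> g (t i) \<bullet> dirv \<theta>"
      using i x by (simp add: dist_norm norm_minus_commute inner_diff_left)
    then show ?thesis using i by blast
  qed
  have closed: "g (t N) = g (t 0)"
    using g(2) N by (simp add: t_def pathfinish_def pathstart_def)
  have var: "2 * (supp C \<theta> + supp C (\<theta> + pi)) - 4 * e \<le>
      (\<Sum>i<N. \<bar>g (t (Suc i)) \<bullet> dirv \<theta> - g (t i) \<bullet> dirv \<theta>\<bar>)" for \<theta>
  proof -
    obtain i where i: "i \<le> N" "supp C \<theta> - e \<le> g (t i) \<bullet> dirv \<theta>"
      using nearx by blast
    obtain j where j: "j \<le> N" "supp C (\<theta> + pi) - e \<le> - (g (t j) \<bullet> dirv \<theta>)"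
      using nearx[of "\<theta> + pi"] by (auto simp: dirv_plus_pi)
    show ?thesis
      using closed_variation_ge[of "\<lambda>i. g (t i) \<bullet> dirv \<theta>" N j i] closed i j by simp
  qed
  note cont = continuous_on_supp[OF C(1) C']
  have cont2: "continuous_on {0..2 * pi} (\<lambda>\<theta>. supp C \<theta> + supp C (\<theta> + pi))"
    by (intro continuous_on_compose2[OF cont] continuous_intros) auto
  have "4 * integral {0..2 * pi} (supp C) - 8 * pi * e =
      integral {0..2 * pi} (\<lambda>\<theta>. 2 * (supp C \<theta> + supp C (\<theta> + pi)) - 4 * e)"
    using integral_width[OF C(1) C']
    by (subst integral_diff)
      (auto simp del: distrib_left_numeral
        intro!: integrable_continuous_real continuous_on_mult_left cont2 continuous_on_const)
  also have "\<dots> \<le> crofton * (\<Sum>i<N. dist (g (t i)) (g (t (Suc i))))"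
    unfolding crofton_polygon[where p = "\<lambda>i. g (t i)"]
  proof (intro integral_le integrable_continuous_real)
    show "continuous_on {0..2 * pi} (\<lambda>\<theta>. 2 * (supp C \<theta> + supp C (\<theta> + pi)) - 4 * e)"
      by (intro continuous_on_diff continuous_on_mult_left cont2 continuous_on_const)
  qed (intro continuous_intros, rule var)
  finally have "perimeter C - 8 * pi * e / crofton \<le> (\<Sum>i<N. dist (g (t i)) (g (t (Suc i))))"
    using crofton_pos by (simp add: perimeter_def field_simps)
  then show ?thesis using that t1 by blast
qed

text \<open>The right-hand side does not mention \<open>g\<close>, so the length is the same for all
  simple closed parametrizations of the frontier.\<close>

lemma path_length_eq_perimeter:
  assumes C: "compact C" "convex C" "interior C \<noteq> {}"
    and g: "simple_path g" "pathfinish g = pathstart g" "path_image g = frontier C"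
  shows "path_length g = ereal (perimeter C)"
proof (rule antisym)
  show "path_length g \<le> ereal (perimeter C)"
    unfolding path_length_def using polygon_le_perimeter[OF C g(1,3)]
    by (intro SUP_least) auto
  show "ereal (perimeter C) \<le> path_length g"
  proof (rule ereal_le_epsilon2)
    fix r :: real assume "0 < r"
    define e where "e = r * crofton / (8 * pi)"
    have "0 < e" using \<open>0 < r\<close> crofton_pos by (simp add: e_def)
    then obtain n :: nat and t :: "nat \<Rightarrow> real" where nt: "mono_on {..n} t" "t ` {..n} \<subseteq> {0..1}"
      "perimeter C - 8 * pi * e / crofton \<le> (\<Sum>i<n. dist (g (t i)) (g (t (Suc i))))"
      using ex_polygon_ge_perimeter[OF C g] by blast
    have "8 * pi * e / crofton = r" using crofton_pos by (simp add: e_def)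
    then have "ereal (perimeter C) \<le> ereal (\<Sum>i<n. dist (g (t i)) (g (t (Suc i)))) + ereal r"
      using nt(3) by simp
    also have "\<dots> \<le> path_length g + ereal r"
      unfolding path_length_def using nt(1,2)
      by (intro add_right_mono SUP_upper2[of "(n, t)"]) auto
    finally show "ereal (perimeter C) \<le> path_length g + ereal r" .
  qed
qed

lemma simple_closed_curve_length_frontier_iff:
  assumes C: "compact C" "convex C" "interior C \<noteq> {}"
  shows "simple_closed_curve_length (frontier C) L \<longleftrightarrow> L = perimeter C"
proof
  show "simple_closed_curve_length (frontier C) L \<Longrightarrow> L = perimeter C"
    unfolding simple_closed_curve_length_def using path_length_eq_perimeter[OF C] by auto
  show "L = perimeter C \<Longrightarrow> simple_closed_curve_length (frontier C) L"
    unfolding simple_closed_curve_length_def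
    using ex_simple_closed_frontier[OF C] path_length_eq_perimeter[OF C] by metis
qed

section \<open>Cap bodies and strictly convex sets\<close>

lemma convex_hull_insert_body:
  fixes K :: "(real^2) set"
  assumes "compact K" "interior K \<noteq> {}"
  shows "compact (convex hull ({P} \<union> K))" "convex (convex hull ({P} \<union> K))"
    "interior (convex hull ({P} \<union> K)) \<noteq> {}"
proof -
  show "compact (convex hull ({P} \<union> K))"
    using assms(1) by (simp add: compact_convex_hull)
  have "interior K \<subseteq> interior (convex hull ({P} \<union> K))"
    using hull_subset[of "{P} \<union> K" convex] by (intro interior_mono) simp
  then show "interior (convex hull ({P} \<union> K)) \<noteq> {}"
    using assms(2) by blast
qed simp

lemma supp_convex_hull_insert:
  assumes "compact K" "K \<noteq> {}"
  shows "supp (convex hull ({P} \<union> K)) \<theta> = max (supp K \<theta>) (P \<bullet> dirv \<theta>)"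
proof (rule antisym)
  let ?H = "{x. dirv \<theta> \<bullet> x \<le> max (supp K \<theta>) (P \<bullet> dirv \<theta>)}"
  have "convex hull ({P} \<union> K) \<subseteq> ?H"
  proof (rule hull_minimal)
    show "{P} \<union> K \<subseteq> ?H"
      using supp_ge[OF assms(1), of _ \<theta>] by (auto simp: inner_commute[of "dirv \<theta>"] le_max_iff_disj)
  qed (rule convex_halfspace_le)
  then show "supp (convex hull ({P} \<union> K)) \<theta> \<le> max (supp K \<theta>) (P \<bullet> dirv \<theta>)"
    by (intro supp_le) (auto simp: inner_commute[of "dirv \<theta>"])
  have H: "compact (convex hull ({P} \<union> K))"
    using assms(1) by (simp add: compact_convex_hull)
  have sub: "P \<in> convex hull ({P} \<union> K)" "K \<subseteq> convex hull ({P} \<union> K)"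
    using hull_subset[of "{P} \<union> K" convex] by auto
  then show "max (supp K \<theta>) (P \<bullet> dirv \<theta>) \<le> supp (convex hull ({P} \<union> K)) \<theta>"
    using supp_ge[OF H sub(1)] supp_ge[OF H] by (auto intro!: supp_le assms(2))
qed

text \<open>The gain in the integral of the support function when \<open>P\<close> is added to the
  body. It depends on a function \<open>h\<close> and not on a set, so that the study of its level
  curve is pure analysis of \<open>h\<close>.\<close>

definition excess :: "(real \<Rightarrow> real) \<Rightarrow> real^2 \<Rightarrow> real" where
  "excess h P = integral {0..2 * pi} (\<lambda>\<theta>. max 0 (P \<bullet> dirv \<theta> - h \<theta>))"

lemma perimeter_convex_hull_insert:
  assumes "compact K" "K \<noteq> {}"
  shows "perimeter (convex hull ({P} \<union> K)) = perimeter K + 4 / crofton * excess (supp K) P"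
proof -
  have "supp (convex hull ({P} \<union> K)) = (\<lambda>\<theta>. supp K \<theta> + max 0 (P \<bullet> dirv \<theta> - supp K \<theta>))"
    unfolding supp_convex_hull_insert[OF assms] by (auto simp: fun_eq_iff)
  moreover have "integral {0..2 * pi} (\<lambda>\<theta>. supp K \<theta> + max 0 (P \<bullet> dirv \<theta> - supp K \<theta>)) =
      integral {0..2 * pi} (supp K) + excess (supp K) P"
    unfolding excess_def
    by (intro integral_add integrable_continuous_real continuous_intros
        continuous_on_subset[OF continuous_on_supp[OF assms]]) auto
  ultimately show ?thesis
    by (simp add: perimeter_def distrib_left)
qed

lemma string_construction_eq:
  assumes K: "compact K" "interior K \<noteq> {}"
  shows "string_construction K (perimeter K + 4 / crofton * T) = {P. excess (supp K) P = T}"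
proof -
  have ne: "K \<noteq> {}" using K(2) interior_subset by blast
  have "simple_closed_curve_length (frontier (convex hull ({P} \<union> K))) (perimeter K + 4 / crofton * T)
      \<longleftrightarrow> excess (supp K) P = T" for P
    unfolding simple_closed_curve_length_frontier_iff[OF convex_hull_insert_body[OF K]]
      perimeter_convex_hull_insert[OF K(1) ne]
    using crofton_pos by auto
  then show ?thesis
    unfolding string_construction_def by blast
qed

text \<open>The maximizers in a direction form a convex subset of the frontier, hence contain the
  segment between any two of them.\<close>

lemma strictly_convex_supporting_point_unique:
  fixes K :: "(real^2) set"
  assumes K: "compact K" "strictly_convex K"
    and x: "x \<in> K" "x \<bullet> dirv \<theta> = supp K \<theta>" and y: "y \<in> K" "y \<bullet> dirv \<theta> = supp K \<theta>"
  shows "x = y"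
proof -
  have "closed_segment x y \<subseteq> frontier K"
  proof
    fix p assume p: "p \<in> closed_segment x y"
    have pK: "p \<in> K"
      using p x y K(2) by (meson closed_segment_subset strictly_convex_def subsetD)
    have ps: "p \<bullet> dirv \<theta> = supp K \<theta>"
    proof -
      obtain u where "p = (1 - u) *\<^sub>R x + u *\<^sub>R y"
        using p by (auto simp: in_segment)
      then show ?thesis
        using x y by (simp add: inner_add_left flip: distrib_right)
    qed
    have "p \<notin> interior K"
    proof
      assume "p \<in> interior K"
      then obtain e where e: "0 < e" "cball p e \<subseteq> K"
        by (auto simp: mem_interior_cball)
      then have "p + e *\<^sub>R dirv \<theta> \<in> K"
        by (auto simp: dist_norm subset_iff)
      from supp_ge[OF K(1) this, of \<theta>] show False
        using ps e by (simp add: inner_add_left inner_dirv_dirv)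
    qed
    then show "p \<in> frontier K"
      using pK K(1) by (simp add: frontier_def compact_imp_closed)
  qed
  then show ?thesis
    using K(2) by (simp add: strictly_convex_def)
qed

section \<open>Differentiability of the support function\<close>

lemma norm_dirv_diff_le: "norm (dirv a - dirv b) \<le> \<bar>a - b\<bar>"
proof (rule power2_le_imp_le)
  have "(norm (dirv a - dirv b))\<^sup>2 = 2 - 2 * cos (2 * ((a - b) / 2))"
    unfolding power2_norm_eq_inner using cos_minus[of "a - b"]
    by (simp add: inner_diff_left inner_diff_right inner_dirv_dirv diff_divide_distrib)
  also have "\<dots> = (2 * \<bar>sin ((a - b) / 2)\<bar>)\<^sup>2"
    unfolding cos_double_sin by (simp add: power_mult_distrib)
  also have "\<dots> \<le> \<bar>a - b\<bar>\<^sup>2"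
    using abs_sin_x_le_abs_x[of "(a - b) / 2"] by (intro power_mono) auto
  finally show "(norm (dirv a - dirv b))\<^sup>2 \<le> \<bar>a - b\<bar>\<^sup>2" .
qed simp

(* The support function is differentiable because the supporting point depends continuously on
   the direction, and this is what strict convexity provides. *)
lemma strictly_convex_supp_deriv:
  fixes K :: "(real^2) set"
  assumes K: "compact K" "strictly_convex K" "K \<noteq> {}"
  obtains \<gamma> where "\<And>\<theta>. \<gamma> \<theta> \<in> K" "continuous_on UNIV \<gamma>"
    "\<And>\<theta>. (supp K has_real_derivative \<gamma> \<theta> \<bullet> dirv (\<theta> + pi / 2)) (at \<theta>)"
proof -
  have "\<exists>x. x \<in> K \<and> x \<bullet> dirv \<theta> = supp K \<theta>" for \<theta>
    using supp_attained[OF K(1,3), of \<theta>] by blast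
  then obtain \<gamma> where \<gamma>: "\<And>\<theta>. \<gamma> \<theta> \<in> K" "\<And>\<theta>. \<gamma> \<theta> \<bullet> dirv \<theta> = supp K \<theta>"
    by metis
  \<comment> \<open>Uniqueness turns the graph of \<gamma> into the set of all solutions of a closed
    condition; a closed graph over a compact range gives continuity.\<close>
  have "(\<lambda>\<theta>. (\<theta>, \<gamma> \<theta>)) ` UNIV = {z. snd z \<in> K \<and> snd z \<bullet> dirv (fst z) = supp K (fst z)}"
  proof (intro equalityI subsetI)
    fix z assume "z \<in> {z. snd z \<in> K \<and> snd z \<bullet> dirv (fst z) = supp K (fst z)}"
    then have "snd z = \<gamma> (fst z)"
      by (intro strictly_convex_supporting_point_unique[OF K(1,2) _ _ \<gamma>]) auto
    then have "z = (fst z, \<gamma> (fst z))"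
      by (simp add: prod_eq_iff)
    then show "z \<in> (\<lambda>\<theta>. (\<theta>, \<gamma> \<theta>)) ` UNIV" by blast
  qed (auto simp: \<gamma>)
  also have "closed \<dots>"
  proof (rule closed_Collect_conj)
    show "closed {z :: real \<times> (real^2). snd z \<in> K}"
      using closed_vimage[of K snd] K(1)
      by (simp add: vimage_def compact_imp_closed continuous_on_snd continuous_on_id)
    have "continuous_on UNIV (\<lambda>z :: real \<times> (real^2). supp K (fst z))"
      by (rule continuous_on_compose2[OF continuous_on_supp[OF K(1,3)] continuous_on_fst[OF continuous_on_id]]) simp
    then show "closed {z. snd z \<bullet> dirv (fst z) = supp K (fst z)}"
      by (intro closed_Collect_eq continuous_on_inner continuous_on_dirv
          continuous_on_fst continuous_on_snd continuous_on_id)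
  qed
  finally have cont: "continuous_on UNIV \<gamma>"
    using K(1) \<gamma>(1) by (intro continuous_from_closed_graph) auto
  have "(supp K has_real_derivative \<gamma> \<theta> \<bullet> dirv (\<theta> + pi / 2)) (at \<theta>)" for \<theta>
  proof -
    \<comment> \<open>The gap between the support function and that of the single point
      \<open>\<gamma> \<theta>\<close>. It is nonnegative and zero at \<theta>, so an upper bound of
      smaller order than the distance from \<theta> suffices.\<close>
    define e where "e s = supp K s - \<gamma> \<theta> \<bullet> dirv s" for s
    have e0: "e \<theta> = 0" by (simp add: e_def \<gamma>)
    have "\<bar>e s\<bar> \<le> norm (\<gamma> s - \<gamma> \<theta>) * \<bar>s - \<theta>\<bar>" for s
    proof -
      have "0 \<le> e s" using supp_ge[OF K(1) \<gamma>(1)] by (simp add: e_def)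
      \<comment> \<open>The added term
        \<open>- ((\<gamma> s - \<gamma> \<theta>) \<bullet> dirv \<theta>)\<close> is nonnegative,
        because \<open>\<gamma> \<theta>\<close> is a maximizer in direction \<theta>.\<close>
      moreover have "e s \<le> (\<gamma> s - \<gamma> \<theta>) \<bullet> (dirv s - dirv \<theta>)"
        using supp_ge[OF K(1) \<gamma>(1), of s \<theta>]
        by (simp add: e_def \<gamma> inner_diff_left inner_diff_right)
      moreover have "\<dots> \<le> norm (\<gamma> s - \<gamma> \<theta>) * norm (dirv s - dirv \<theta>)"
        by (rule norm_cauchy_schwarz)
      moreover have "\<dots> \<le> norm (\<gamma> s - \<gamma> \<theta>) * \<bar>s - \<theta>\<bar>"
        by (intro mult_left_mono norm_dirv_diff_le) simp
      ultimately show ?thesis by linarith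
    qed
    then have bound: "norm ((e s - e \<theta>) / (s - \<theta>)) \<le> norm (\<gamma> s - \<gamma> \<theta>)" for s
      by (cases "s = \<theta>") (simp_all add: e0 abs_divide divide_le_eq)
    have "(\<gamma> \<longlongrightarrow> \<gamma> \<theta>) (at \<theta>)"
      using cont by (simp add: continuous_on_eq_continuous_at isCont_def)
    then have lim: "((\<lambda>s. norm (\<gamma> s - \<gamma> \<theta>)) \<longlongrightarrow> 0) (at \<theta>)"
      by (intro tendsto_norm_zero LIM_zero)
    have "((\<lambda>s. (e s - e \<theta>) / (s - \<theta>)) \<longlongrightarrow> 0) (at \<theta>)"
      by (intro Lim_null_comparison[OF _ lim] always_eventually allI bound)
    then have "(e has_real_derivative 0) (at \<theta>)"
      by (simp add: has_field_derivative_iff)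
    moreover have "((\<lambda>s. \<gamma> \<theta> \<bullet> dirv s) has_real_derivative \<gamma> \<theta> \<bullet> dirv (\<theta> + pi / 2)) (at \<theta>)"
      unfolding has_real_derivative_iff_has_vector_derivative
      by (intro bounded_linear.has_vector_derivative[OF bounded_linear_inner_right] has_vector_derivative_dirv)
    ultimately have "((\<lambda>s. e s + \<gamma> \<theta> \<bullet> dirv s) has_real_derivative 0 + \<gamma> \<theta> \<bullet> dirv (\<theta> + pi / 2)) (at \<theta>)"
      by (rule DERIV_add)
    then show ?thesis by (simp add: e_def)
  qed
  with \<gamma>(1) cont show ?thesis by (rule that)
qed

text \<open>The product rule for a factor \<open>g\<close> that is merely continuous, paid for by
  the zero of \<open>f\<close>. It serves where a quantity is to be differentiated while its
  companion is so far known only to be continuous.\<close>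

lemma DERIV_mult_vanishing:
  fixes f g :: "real \<Rightarrow> real"
  assumes "(f has_real_derivative d) (at x)" "f x = 0" "isCont g x"
  shows "((\<lambda>y. f y * g y) has_real_derivative d * g x) (at x)"
proof -
  obtain k where k: "\<And>z. f z - f x = k z * (z - x)" "isCont k x" "k x = d"
    using assms(1) unfolding CARAT_DERIV by blast
  have "f z = k z * (z - x)" for z
    using k(1)[of z] assms(2) by simp
  then show ?thesis
    unfolding CARAT_DERIV
    using k assms(2,3) by (intro exI[of _ "\<lambda>z. k z * g z"]) auto
qed

lemma DERIV_inner_vanishing:
  fixes f g :: "real \<Rightarrow> real^2"
  assumes f: "(f has_vector_derivative d) (at x)" "f x = 0" and g: "isCont g x"
  shows "((\<lambda>y. f y \<bullet> g y) has_real_derivative d \<bullet> g x) (at x)"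
proof -
  have "((\<lambda>y. f y $ i) has_real_derivative d $ i) (at x)" for i
    unfolding has_real_derivative_iff_has_vector_derivative
    using bounded_linear.has_vector_derivative[OF bounded_linear_vec_nth f(1)] .
  moreover have "isCont (\<lambda>y. g y $ i) x" for i
    using g by (intro continuous_intros)
  ultimately have "((\<lambda>y. f y $ i * g y $ i) has_real_derivative d $ i * g x $ i) (at x)" for i
    using f(2) by (intro DERIV_mult_vanishing) auto
  then show ?thesis
    unfolding inner_real2 by (intro DERIV_add)
qed

text \<open>The difference \<open>f - l\<close> is caught between 0 and \<open>u - l\<close>, whose
  difference quotient tends to 0. Applied to the radius, for which only two-sided estimates are at
  hand.\<close>

lemma DERIV_squeeze:
  fixes f l u :: "real \<Rightarrow> real"
  assumes l: "(l has_real_derivative d) (at x)" and u: "(u has_real_derivative d) (at x)"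
    and eq: "l x = f x" "u x = f x" and le: "\<forall>\<^sub>F y in at x. l y \<le> f y \<and> f y \<le> u y"
  shows "(f has_real_derivative d) (at x)"
proof -
  have "((\<lambda>y. u y - l y) has_real_derivative d - d) (at x)"
    by (intro DERIV_diff l u)
  then have lim: "((\<lambda>y. norm ((u y - l y) / (y - x))) \<longlongrightarrow> 0) (at x)"
    using eq by (intro tendsto_norm_zero) (simp add: has_field_derivative_iff)
  have bound: "\<forall>\<^sub>F y in at x. norm ((f y - l y) / (y - x)) \<le> norm ((u y - l y) / (y - x))"
    using le by eventually_elim (simp add: abs_divide divide_right_mono)
  have "((\<lambda>y. (f y - l y) / (y - x)) \<longlongrightarrow> 0) (at x)"
    by (rule Lim_null_comparison[OF bound lim])
  then have "((\<lambda>y. f y - l y) has_real_derivative 0) (at x)"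
    using eq by (simp add: has_field_derivative_iff)
  from DERIV_add[OF this l] show ?thesis by simp
qed

section \<open>The level curve in polar coordinates\<close>

text \<open>The data of a body enter only through its support function. The bound on
  \<open>T\<close> is tuned to \<open>R_large\<close>: the excess vanishes at the origin and has
  Lipschitz constant \<open>2 * pi\<close>, so every point of the level curve is farther than
  \<open>2 * M\<close> from the origin.\<close>

locale long_string =
  fixes h h' :: "real \<Rightarrow> real" and M T :: real
  assumes h_deriv: "(h has_real_derivative h' \<theta>) (at \<theta>)"
    and h'_cont: "continuous_on UNIV h'"
    and h_periodic: "h (\<theta> + 2 * pi) = h \<theta>"
    and h_pos: "0 < h \<theta>" and h_le: "h \<theta> \<le> M" and h'_le: "\<bar>h' \<theta>\<bar> \<le> M"
    and T_large: "4 * pi * M < T"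
begin

section \<open>Growth of the excess along rays and the polar radius\<close>

lemma h_cont: "continuous_on A h"
  using h_deriv by (meson DERIV_isCont continuous_at_imp_continuous_on)

lemma M_pos: "0 < M"
  using h_pos[of 0] h_le[of 0] by linarith

lemma T_pos: "0 < T"
proof -
  have "0 < 4 * pi * M" using M_pos by simp
  then show ?thesis using T_large by linarith
qed

lemma integrand_cont: "continuous_on A (\<lambda>\<theta>. max 0 (P \<bullet> dirv \<theta> - h \<theta>))"
  by (intro continuous_intros h_cont)

lemma integrand_integrable: "(\<lambda>\<theta>. max 0 (P \<bullet> dirv \<theta> - h \<theta>)) integrable_on {a..b}"
  by (intro integrable_continuous_real integrand_cont)

lemma excess_window:
  "excess h P = integral {a..a + 2 * pi} (\<lambda>\<theta>. max 0 (P \<bullet> dirv \<theta> - h \<theta>))"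
  unfolding excess_def
  by (rule integral_period_shift[symmetric]) (auto simp: h_periodic intro: integrand_cont)

lemma excess_lipschitz: "excess h P \<le> excess h Q + 2 * pi * norm (P - Q)"
proof -
  have "max 0 (P \<bullet> dirv \<theta> - h \<theta>) \<le> max 0 (Q \<bullet> dirv \<theta> - h \<theta>) + norm (P - Q)" for \<theta>
    using norm_cauchy_schwarz[of "P - Q" "dirv \<theta>"] norm_ge_zero[of "P - Q"]
    by (simp add: inner_diff_left)
  then have "excess h P \<le> integral {0..2 * pi} (\<lambda>\<theta>. max 0 (Q \<bullet> dirv \<theta> - h \<theta>) + norm (P - Q))"
    unfolding excess_def
    by (intro integral_le integrand_integrable integrable_add integrable_const_ivl)
  also have "\<dots> = excess h Q + 2 * pi * norm (P - Q)"
    unfolding excess_def by (subst integral_add) (auto intro: integrand_integrable)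
  finally show ?thesis .
qed

lemma excess_0: "excess h 0 = 0"
proof -
  have "max 0 (0 \<bullet> dirv \<theta> - h \<theta>) = 0" for \<theta>
    using h_pos[of \<theta>] by simp
  then show ?thesis by (simp add: excess_def)
qed

text \<open>Convexity along a ray starting at a zero. Once positive, the excess grows strictly along
  the ray, which makes the radius unique.\<close>

lemma excess_scale:
  assumes "0 \<le> r" "r \<le> s" "0 < s"
  shows "excess h (r *\<^sub>R u) \<le> r / s * excess h (s *\<^sub>R u)"
proof -
  have "max 0 ((r *\<^sub>R u) \<bullet> dirv \<theta> - h \<theta>) \<le> r / s * max 0 ((s *\<^sub>R u) \<bullet> dirv \<theta> - h \<theta>)" for \<theta>
  proof -
    have "r * (u \<bullet> dirv \<theta>) - h \<theta> \<le> r * (u \<bullet> dirv \<theta>) - r / s * h \<theta>"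
      using assms h_pos[of \<theta>] by (simp add: divide_le_eq mult_right_mono)
    also have "\<dots> = r / s * (s * (u \<bullet> dirv \<theta>) - h \<theta>)"
      using assms by (simp add: field_simps)
    also have "\<dots> \<le> r / s * max 0 (s * (u \<bullet> dirv \<theta>) - h \<theta>)"
      using assms by (intro mult_left_mono) auto
    finally show ?thesis using assms by simp
  qed
  then have "excess h (r *\<^sub>R u) \<le>
      integral {0..2 * pi} (\<lambda>\<theta>. r / s * max 0 ((s *\<^sub>R u) \<bullet> dirv \<theta> - h \<theta>))"
    unfolding excess_def
    by (intro integral_le integrand_integrable integrable_on_cmult_left[where 'b = real, unfolded real_scaleR_def]
        integrable_on_mult_right)
  then show ?thesis
    unfolding excess_def by simp
qed

text \<open>On a sector of angle \<open>pi / 3\<close> beside \<phi> the cosine is at least 1/2, so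
  the integrand there is at least \<open>r / 2 - M\<close>.\<close>

lemma excess_ge:
  assumes "0 \<le> r"
  shows "pi / 3 * (r / 2 - M) \<le> excess h (r *\<^sub>R dirv \<phi>)"
proof -
  let ?f = "\<lambda>\<theta>. max 0 ((r *\<^sub>R dirv \<phi>) \<bullet> dirv \<theta> - h \<theta>)"
  have "r / 2 - M \<le> ?f \<theta>" if "\<theta> \<in> {\<phi>..\<phi> + pi / 3}" for \<theta>
  proof -
    have "cos (pi / 3) \<le> cos (\<theta> - \<phi>)"
      using that by (intro cos_monotone_0_pi_le) auto
    moreover have "cos (\<theta> - \<phi>) = cos (\<phi> - \<theta>)"
      using cos_minus[of "\<theta> - \<phi>"] by simp
    ultimately have "r * (1 / 2) \<le> r * cos (\<phi> - \<theta>)"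
      using assms by (intro mult_left_mono) (auto simp: cos_60)
    then show ?thesis using h_le[of \<theta>] by (simp add: inner_dirv_dirv)
  qed
  then have "integral {\<phi>..\<phi> + pi / 3} (\<lambda>\<theta>. r / 2 - M) \<le> integral {\<phi>..\<phi> + pi / 3} ?f"
    by (intro integral_le integrand_integrable integrable_const_ivl)
  also have "\<dots> \<le> integral {\<phi>..\<phi> + 2 * pi} ?f"
    by (intro integral_subset_le integrand_integrable) auto
  also have "\<dots> = excess h (r *\<^sub>R dirv \<phi>)"
    by (rule excess_window[symmetric])
  finally show ?thesis by simp
qed

text \<open>The solution \<open>r\<close> of \<open>pi / 3 * (r / 2 - M) = T\<close>, the radius at
  which \<open>excess_ge\<close> guarantees the value \<open>T\<close>.\<close>

definition bound :: real where "bound = 2 * M + 6 * T / pi"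

lemma radius_le_bound:
  assumes "0 \<le> r" "excess h (r *\<^sub>R dirv \<phi>) = T"
  shows "r \<le> bound"
proof -
  have "pi / 3 * (r / 2 - M) \<le> T"
    using excess_ge[OF assms(1), of \<phi>] assms(2) by simp
  then show ?thesis
    by (simp add: bound_def field_simps)
qed

lemma ex_radius: "\<exists>r\<ge>0. excess h (r *\<^sub>R dirv \<phi>) = T"
proof -
  have "0 \<le> bound" using M_pos T_pos by (simp add: bound_def)
  have "2 * pi * norm (r *\<^sub>R dirv \<phi> - s *\<^sub>R dirv \<phi>) = 2 * pi * \<bar>r - s\<bar>" for r s
    by (simp flip: scaleR_diff_left)
  then have "\<bar>excess h (r *\<^sub>R dirv \<phi>) - excess h (s *\<^sub>R dirv \<phi>)\<bar> \<le> 2 * pi * \<bar>r - s\<bar>" for r s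
    using excess_lipschitz[of "r *\<^sub>R dirv \<phi>" "s *\<^sub>R dirv \<phi>"]
      excess_lipschitz[of "s *\<^sub>R dirv \<phi>" "r *\<^sub>R dirv \<phi>"] by (simp add: norm_minus_commute abs_le_iff)
  then have "(2 * pi)-lipschitz_on {0..bound} (\<lambda>r. excess h (r *\<^sub>R dirv \<phi>))"
    by (intro lipschitz_onI) (auto simp: dist_real_def)
  then have "continuous_on {0..bound} (\<lambda>r. excess h (r *\<^sub>R dirv \<phi>))"
    by (rule lipschitz_on_continuous_on)
  moreover have "T = pi / 3 * (bound / 2 - M)"
    by (simp add: bound_def field_simps)
  then have "T \<le> excess h (bound *\<^sub>R dirv \<phi>)"
    using excess_ge[OF \<open>0 \<le> bound\<close>, of \<phi>] by simp
  ultimately show ?thesis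
    using IVT'[of "\<lambda>r. excess h (r *\<^sub>R dirv \<phi>)" 0 T bound] \<open>0 \<le> bound\<close> T_pos
    by (auto simp: excess_0)
qed

lemma radius_unique:
  assumes "0 \<le> r" "0 \<le> s" "excess h (r *\<^sub>R u) = T" "excess h (s *\<^sub>R u) = T"
  shows "r = s"
proof -
  have *: False if "0 \<le> r" "r < s" "excess h (r *\<^sub>R u) = T" "excess h (s *\<^sub>R u) = T" for r s
  proof -
    have "T \<le> r / s * T" using excess_scale[of r s u] that by simp
    moreover have "r / s * T < 1 * T"
      using that T_pos by (intro mult_strict_right_mono) (auto simp: divide_less_eq)
    ultimately show False by simp
  qed
  show ?thesis using *[of r s] *[of s r] assms by (cases r s rule: linorder_cases) auto
qed

definition R :: "real \<Rightarrow> real" where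
  "R \<phi> = (THE r. 0 \<le> r \<and> excess h (r *\<^sub>R dirv \<phi>) = T)"

lemma R_nonneg: "0 \<le> R \<phi>" and excess_R: "excess h (R \<phi> *\<^sub>R dirv \<phi>) = T"
proof -
  have "\<exists>!r. 0 \<le> r \<and> excess h (r *\<^sub>R dirv \<phi>) = T"
    using ex_radius radius_unique by blast
  from theI'[OF this] show "0 \<le> R \<phi>" "excess h (R \<phi> *\<^sub>R dirv \<phi>) = T"
    by (simp_all add: R_def)
qed

lemma R_eqI: "0 \<le> r \<Longrightarrow> excess h (r *\<^sub>R dirv \<phi>) = T \<Longrightarrow> R \<phi> = r"
  using radius_unique R_nonneg excess_R by blast

lemma R_le_bound: "R \<phi> \<le> bound"
  using radius_le_bound R_nonneg excess_R by blast

lemma R_large: "2 * M < R \<phi>"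
proof -
  have "T \<le> 2 * pi * R \<phi>"
    using excess_lipschitz[of "R \<phi> *\<^sub>R dirv \<phi>" 0] R_nonneg[of \<phi>]
    by (simp add: excess_R excess_0)
  then have "(2 * pi) * (2 * M) < (2 * pi) * R \<phi>"
    using T_large by linarith
  then show ?thesis
    by (rule mult_left_less_imp_less) simp
qed

lemma R_pos: "0 < R \<phi>"
  using R_large[of \<phi>] M_pos by linarith

text \<open>The function \<open>k s = r * cos s - h (\<phi> + \<sigma> * s)\<close> is positive up
  to \<open>pi / 3\<close> because \<open>M < r / 2\<close>, negative from \<open>pi / 2\<close> to
  \<open>pi\<close> because \<open>h\<close> is positive, and strictly decreasing in between because
  \<open>r * sin s\<close> exceeds \<open>M\<close> and hence the derivative of \<open>h\<close>. So
  it has exactly one zero \<open>b\<close>. The sign \<sigma> selects the side;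
  \<open>M < r * sin b\<close> is the transversality needed for implicit differentiation.\<close>

lemma tangent_angle:
  assumes r: "2 * M < r" and \<sigma>: "\<sigma> = 1 \<or> \<sigma> = -1"
  obtains b where "0 \<le> b" "b \<le> pi / 2" "h (\<phi> + \<sigma> * b) = r * cos b" "M < r * sin b"
    "1 / 2 \<le> sin b"
    "\<And>s. 0 \<le> s \<Longrightarrow> s \<le> b \<Longrightarrow> h (\<phi> + \<sigma> * s) \<le> r * cos s"
    "\<And>s. b \<le> s \<Longrightarrow> s \<le> pi \<Longrightarrow> r * cos s \<le> h (\<phi> + \<sigma> * s)"
    "\<And>s. 0 \<le> s \<Longrightarrow> s \<le> pi / 2 \<Longrightarrow> h (\<phi> + \<sigma> * s) = r * cos s \<Longrightarrow> s = b"
proof -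
  define k where "k s = r * cos s - h (\<phi> + \<sigma> * s)" for s
  have r0: "0 < r" using r M_pos by linarith
  have k_deriv: "(k has_real_derivative - r * sin s - \<sigma> * h' (\<phi> + \<sigma> * s)) (at s)" for s
    unfolding k_def
    by (rule derivative_eq_intros DERIV_chain2[OF h_deriv] refl | simp)+
  have k_pos: "0 < k s" if "0 \<le> s" "s \<le> pi / 3" for s
  proof -
    have "cos (pi / 3) \<le> cos s" using that by (intro cos_monotone_0_pi_le) auto
    then have "r * (1 / 2) \<le> r * cos s" using r0 by (intro mult_left_mono) (auto simp: cos_60)
    then show ?thesis using h_le[of "\<phi> + \<sigma> * s"] r by (simp add: k_def)
  qed
  have sin_ge: "1 / 2 \<le> sin s" if "pi / 3 \<le> s" "s \<le> pi / 2" for s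
  proof -
    have "sin (pi / 6) \<le> sin s" using that by (intro sin_monotone_2pi_le) auto
    then show ?thesis by (simp add: sin_30)
  qed
  have rsin: "M < r * sin s" if "pi / 3 \<le> s" "s \<le> pi / 2" for s
  proof -
    have "r * (1 / 2) \<le> r * sin s" using r0 sin_ge[OF that] by (intro mult_left_mono) auto
    then show ?thesis using r by simp
  qed
  have k_less: "k t < k s" if "pi / 3 \<le> s" "s < t" "t \<le> pi / 2" for s t
  proof (rule DERIV_neg_imp_decreasing[OF that(2)])
    fix x assume x: "s \<le> x" "x \<le> t"
    have "\<bar>\<sigma> * h' (\<phi> + \<sigma> * x)\<bar> \<le> M" using \<sigma> h'_le[of "\<phi> + \<sigma> * x"] by auto
    then have "- r * sin x - \<sigma> * h' (\<phi> + \<sigma> * x) < 0"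
      using rsin[of x] x that by auto
    then show "\<exists>y. (k has_real_derivative y) (at x) \<and> y < 0"
      using k_deriv by blast
  qed
  have k_neg: "k s < 0" if "pi / 2 \<le> s" "s \<le> pi" for s
  proof -
    have "cos s \<le> cos (pi / 2)" using that by (intro cos_monotone_0_pi_le) auto
    then have "r * cos s \<le> 0" using r0 by (simp add: mult_nonneg_nonpos)
    then show ?thesis using h_pos[of "\<phi> + \<sigma> * s"] by (simp add: k_def)
  qed
  have "continuous_on {pi / 3..pi / 2} k"
    using k_deriv by (meson DERIV_isCont continuous_at_imp_continuous_on)
  then obtain b where b: "pi / 3 \<le> b" "b \<le> pi / 2" "k b = 0"
    using IVT2'[of k "pi / 2" 0 "pi / 3"] k_pos[of "pi / 3"] k_neg[of "pi / 2"] by auto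
  have k_before: "0 \<le> k s" if "0 \<le> s" "s \<le> b" for s
    using k_pos[of s] k_less[of s b] b that by (cases "s \<le> pi / 3"; cases "s = b") auto
  have k_after: "k s < 0" if "b < s" "s \<le> pi" for s
    using k_neg[of s] k_less[of b s] b that by (cases "s \<le> pi / 2") auto
  show ?thesis
  proof (rule that[of b])
    show "0 \<le> b" using b pi_gt_zero by linarith
    show "s = b" if s: "0 \<le> s" "s \<le> pi / 2" "h (\<phi> + \<sigma> * s) = r * cos s" for s
    proof (rule linorder_cases[of s b])
      assume "s < b"
      then have "0 < k s"
        using k_pos[of s] k_less[of s b] b s by (cases "s \<le> pi / 3") auto
      then show ?thesis using s by (simp add: k_def)
    next
      assume "b < s"
      then show ?thesis using k_after[of s] s pi_gt_zero by (simp add: k_def)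
    qed
    show "r * cos s \<le> h (\<phi> + \<sigma> * s)" if "b \<le> s" "s \<le> pi" for s
      using k_after[of s] b(3) that by (cases "s = b") (auto simp: k_def)
    show "h (\<phi> + \<sigma> * s) \<le> r * cos s" if "0 \<le> s" "s \<le> b" for s
      using k_before[OF that] by (simp add: k_def)
  qed (use b sin_ge[of b] rsin[of b] in \<open>auto simp: k_def\<close>)
qed

text \<open>The equation says that the support line with normal angle
  \<open>\<phi> + \<sigma> * b\<close> passes through the point with polar coordinates
  \<open>R \<phi>\<close> and \<phi>.\<close>

definition B :: "real \<Rightarrow> real \<Rightarrow> real" where
  "B \<sigma> \<phi> = (THE b. 0 \<le> b \<and> b \<le> pi / 2 \<and> h (\<phi> + \<sigma> * b) = R \<phi> * cos b)"

lemma B_props: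
  assumes "\<sigma> = 1 \<or> \<sigma> = -1"
  shows "0 \<le> B \<sigma> \<phi>" "B \<sigma> \<phi> \<le> pi / 2" "h (\<phi> + \<sigma> * B \<sigma> \<phi>) = R \<phi> * cos (B \<sigma> \<phi>)"
    "M < R \<phi> * sin (B \<sigma> \<phi>)" "1 / 2 \<le> sin (B \<sigma> \<phi>)"
    "\<And>s. 0 \<le> s \<Longrightarrow> s \<le> B \<sigma> \<phi> \<Longrightarrow> h (\<phi> + \<sigma> * s) \<le> R \<phi> * cos s"
    "\<And>s. B \<sigma> \<phi> \<le> s \<Longrightarrow> s \<le> pi \<Longrightarrow> R \<phi> * cos s \<le> h (\<phi> + \<sigma> * s)"
    "\<And>s. 0 \<le> s \<Longrightarrow> s \<le> pi / 2 \<Longrightarrow> h (\<phi> + \<sigma> * s) = R \<phi> * cos s \<Longrightarrow> s = B \<sigma> \<phi>"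
proof -
  obtain b where b: "0 \<le> b" "b \<le> pi / 2" "h (\<phi> + \<sigma> * b) = R \<phi> * cos b" "M < R \<phi> * sin b"
    "1 / 2 \<le> sin b"
    "\<And>s. 0 \<le> s \<Longrightarrow> s \<le> b \<Longrightarrow> h (\<phi> + \<sigma> * s) \<le> R \<phi> * cos s"
    "\<And>s. b \<le> s \<Longrightarrow> s \<le> pi \<Longrightarrow> R \<phi> * cos s \<le> h (\<phi> + \<sigma> * s)"
    "\<And>s. 0 \<le> s \<Longrightarrow> s \<le> pi / 2 \<Longrightarrow> h (\<phi> + \<sigma> * s) = R \<phi> * cos s \<Longrightarrow> s = b"
    using tangent_angle[OF R_large[of \<phi>] assms, of \<phi>] by blast
  have "B \<sigma> \<phi> = b"
    unfolding B_def using b(1,2,3,8) by (intro the_equality) blast+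
  then show "0 \<le> B \<sigma> \<phi>" "B \<sigma> \<phi> \<le> pi / 2" "h (\<phi> + \<sigma> * B \<sigma> \<phi>) = R \<phi> * cos (B \<sigma> \<phi>)"
    "M < R \<phi> * sin (B \<sigma> \<phi>)" "1 / 2 \<le> sin (B \<sigma> \<phi>)"
    "\<And>s. 0 \<le> s \<Longrightarrow> s \<le> B \<sigma> \<phi> \<Longrightarrow> h (\<phi> + \<sigma> * s) \<le> R \<phi> * cos s"
    "\<And>s. B \<sigma> \<phi> \<le> s \<Longrightarrow> s \<le> pi \<Longrightarrow> R \<phi> * cos s \<le> h (\<phi> + \<sigma> * s)"
    "\<And>s. 0 \<le> s \<Longrightarrow> s \<le> pi / 2 \<Longrightarrow> h (\<phi> + \<sigma> * s) = R \<phi> * cos s \<Longrightarrow> s = B \<sigma> \<phi>"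
    using b by blast+
qed

end

section \<open>Gradient of the excess along the level curve\<close>

lemma has_vector_derivative_dirv_compose:
  assumes "(f has_real_derivative d) (at x)"
  shows "((\<lambda>x. dirv (f x)) has_vector_derivative d *\<^sub>R dirv (f x + pi / 2)) (at x)"
  using vector_diff_chain_at[OF assms[unfolded has_real_derivative_iff_has_vector_derivative]
      has_vector_derivative_dirv] by (simp add: o_def)

lemma has_integral_inner_dirv:
  assumes "a \<le> b"
  shows "((\<lambda>\<theta>. Q \<bullet> dirv \<theta>) has_integral Q \<bullet> (dirv (b - pi / 2) - dirv (a - pi / 2))) {a..b}"
proof -
  have "((\<lambda>\<theta>. Q \<bullet> dirv (\<theta> - pi / 2)) has_vector_derivative Q \<bullet> dirv x) (at x within {a..b})" for x
  proof -
    have "((\<lambda>\<theta>. \<theta> - pi / 2) has_real_derivative 1) (at x)"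
      by (auto intro!: derivative_eq_intros)
    from has_vector_derivative_dirv_compose[OF this]
    have "((\<lambda>\<theta>. dirv (\<theta> - pi / 2)) has_vector_derivative dirv x) (at x)"
      by simp
    then show ?thesis
      by (rule bounded_linear.has_vector_derivative[OF bounded_linear_inner_right
            has_vector_derivative_at_within])
  qed
  from fundamental_theorem_of_calculus[OF assms this] show ?thesis
    by (simp add: inner_diff_right)
qed

lemma inner_dirv_perp: "dirv a \<bullet> dirv (a + pi / 2) = 0"
  by (simp add: inner_dirv_dirv)

context long_string
begin

definition P :: "real \<Rightarrow> real^2" where "P \<phi> = R \<phi> *\<^sub>R dirv \<phi>"

text \<open>The normal angles of the two tangents from \<open>P \<phi>\<close>. Both are written in
  the shape \<open>\<phi> + \<sigma> * B \<sigma> \<phi>\<close>, so that facts proved for either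
  sign \<sigma> apply by matching.\<close>

definition A1 :: "real \<Rightarrow> real" where "A1 \<phi> = \<phi> + - 1 * B (- 1) \<phi>"
definition A2 :: "real \<Rightarrow> real" where "A2 \<phi> = \<phi> + 1 * B 1 \<phi>"

text \<open>The integral of \<open>dirv\<close> from \<open>A1 \<phi>\<close> to
  \<open>A2 \<phi>\<close>, since \<open>dirv (\<theta> - pi / 2)\<close> is an antiderivative of
  \<open>dirv \<theta>\<close>.\<close>

definition V :: "real \<Rightarrow> real^2" where
  "V \<phi> = dirv (A2 \<phi> - pi / 2) - dirv (A1 \<phi> - pi / 2)"

lemma inner_dirv_V: "dirv \<phi> \<bullet> V \<phi> = sin (B 1 \<phi>) + sin (B (- 1) \<phi>)"
  by (simp add: V_def A1_def A2_def inner_diff_right inner_dirv_dirv cos_add cos_diff sin_diff sin_add)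

text \<open>The radial derivative of the excess stays away from zero, so dividing by it is safe
  everywhere on the curve.\<close>

lemma inner_dirv_V_ge: "1 \<le> dirv \<phi> \<bullet> V \<phi>"
  using B_props(5)[of 1 \<phi>] B_props(5)[of "-1" \<phi>] by (simp add: inner_dirv_V)

lemma norm_V: "norm (V \<phi>) \<le> 2"
  unfolding V_def by (rule order_trans[OF norm_triangle_ineq4]) simp

lemma A1_le_A2: "A1 \<phi> \<le> A2 \<phi>"
  using B_props(1)[of 1 \<phi>] B_props(1)[of "-1" \<phi>] by (simp add: A1_def A2_def)

lemma A_subset: "{A1 \<phi>..A2 \<phi>} \<subseteq> {\<phi> - pi..\<phi> - pi + 2 * pi}"
  using B_props(2)[of 1 \<phi>] B_props(2)[of "-1" \<phi>] pi_gt_zero by (auto simp: A1_def A2_def)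

text \<open>A period centred at \<phi> makes the positive part live on a single interval. Since the
  cosine is even, each half of the period reduces to an offset \<open>s\<close> between 0 and
  \<open>pi\<close> with a sign \<sigma>.\<close>

lemma P_integrand:
  assumes "\<theta> \<in> {\<phi> - pi..\<phi> - pi + 2 * pi}"
  shows "max 0 (P \<phi> \<bullet> dirv \<theta> - h \<theta>) = (if \<theta> \<in> {A1 \<phi>..A2 \<phi>} then P \<phi> \<bullet> dirv \<theta> - h \<theta> else 0)"
proof -
  have *: "max 0 (P \<phi> \<bullet> dirv \<theta> - h \<theta>) = (if s \<le> B \<sigma> \<phi> then P \<phi> \<bullet> dirv \<theta> - h \<theta> else 0)"
    if \<sigma>: "\<sigma> = 1 \<or> \<sigma> = -1" and s: "0 \<le> s" "s \<le> pi" "\<theta> = \<phi> + \<sigma> * s" for \<sigma> s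
  proof -
    have "P \<phi> \<bullet> dirv \<theta> = R \<phi> * cos s"
      using \<sigma> s(3) by (auto simp: P_def inner_dirv_dirv)
    then show ?thesis
      using B_props(6)[OF \<sigma>, of s \<phi>] B_props(7)[OF \<sigma>, of \<phi> s] s by auto
  qed
  show ?thesis
  proof (cases "\<phi> \<le> \<theta>")
    case True
    then have "\<theta> \<in> {A1 \<phi>..A2 \<phi>} \<longleftrightarrow> \<theta> - \<phi> \<le> B 1 \<phi>"
      using B_props(1)[of "-1" \<phi>] by (auto simp: A1_def A2_def)
    then show ?thesis
      using *[of 1 "\<theta> - \<phi>"] assms True by simp
  next
    case False
    then have "\<theta> \<in> {A1 \<phi>..A2 \<phi>} \<longleftrightarrow> \<phi> - \<theta> \<le> B (-1) \<phi>"
      using B_props(1)[of 1 \<phi>] by (auto simp: A1_def A2_def)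
    then show ?thesis
      using *[of "-1" "\<phi> - \<theta>"] assms False by simp
  qed
qed

lemma g_cont: "continuous_on A (\<lambda>\<theta>. Q \<bullet> dirv \<theta> - h \<theta>)"
  by (intro continuous_intros h_cont)

lemma T_eq_integral: "T = integral {A1 \<phi>..A2 \<phi>} (\<lambda>\<theta>. P \<phi> \<bullet> dirv \<theta> - h \<theta>)"
proof -
  have "T = integral {\<phi> - pi..\<phi> - pi + 2 * pi} (\<lambda>\<theta>. max 0 (P \<phi> \<bullet> dirv \<theta> - h \<theta>))"
    using excess_window[of "P \<phi>" "\<phi> - pi"] excess_R[of \<phi>] by (simp add: P_def)
  also have "\<dots> = integral {\<phi> - pi..\<phi> - pi + 2 * pi}
      (\<lambda>\<theta>. if \<theta> \<in> {A1 \<phi>..A2 \<phi>} then P \<phi> \<bullet> dirv \<theta> - h \<theta> else 0)"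
    by (rule integral_cong) (rule P_integrand)
  also have "\<dots> = integral {A1 \<phi>..A2 \<phi>} (\<lambda>\<theta>. P \<phi> \<bullet> dirv \<theta> - h \<theta>)"
    unfolding integral_restrict_Int Int_absorb2[OF A_subset] ..
  finally show ?thesis .
qed

text \<open>With the window of \<phi> held fixed, the integral without positive part is affine in
  the point and never exceeds the excess. \<open>T_eq_integral\<close> makes it exact at
  \<open>P \<phi>\<close>, so it is a supporting affine function there.\<close>

lemma integral_le_T: "integral {A1 \<phi>..A2 \<phi>} (\<lambda>\<theta>. P \<psi> \<bullet> dirv \<theta> - h \<theta>) \<le> T"
proof -
  have "integral {A1 \<phi>..A2 \<phi>} (\<lambda>\<theta>. P \<psi> \<bullet> dirv \<theta> - h \<theta>) \<le>
      integral {A1 \<phi>..A2 \<phi>} (\<lambda>\<theta>. max 0 (P \<psi> \<bullet> dirv \<theta> - h \<theta>))"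
    by (intro integral_le integrable_continuous_real g_cont integrand_cont) simp
  also have "\<dots> \<le> integral {\<phi> - pi..\<phi> - pi + 2 * pi} (\<lambda>\<theta>. max 0 (P \<psi> \<bullet> dirv \<theta> - h \<theta>))"
    by (intro integral_subset_le A_subset integrand_integrable) simp
  also have "\<dots> = T"
    using excess_window[of "P \<psi>" "\<phi> - pi"] excess_R[of \<psi>] by (simp add: P_def)
  finally show ?thesis .
qed

(* V \<phi> is the gradient of the excess at P \<phi>, and the excess is convex. *)
lemma P_diff_inner_V: "(P \<psi> - P \<phi>) \<bullet> V \<phi> \<le> 0"
proof -
  have "((\<lambda>\<theta>. (P \<psi> - P \<phi>) \<bullet> dirv \<theta>) has_integral (P \<psi> - P \<phi>) \<bullet> V \<phi>) {A1 \<phi>..A2 \<phi>}"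
    unfolding V_def by (rule has_integral_inner_dirv[OF A1_le_A2])
  then have "(P \<psi> - P \<phi>) \<bullet> V \<phi> = integral {A1 \<phi>..A2 \<phi>}
      (\<lambda>\<theta>. (P \<psi> \<bullet> dirv \<theta> - h \<theta>) - (P \<phi> \<bullet> dirv \<theta> - h \<theta>))"
    by (simp add: integral_unique inner_diff_left)
  also have "\<dots> = integral {A1 \<phi>..A2 \<phi>} (\<lambda>\<theta>. P \<psi> \<bullet> dirv \<theta> - h \<theta>) -
      integral {A1 \<phi>..A2 \<phi>} (\<lambda>\<theta>. P \<phi> \<bullet> dirv \<theta> - h \<theta>)"
    by (intro integral_diff integrable_continuous_real g_cont)
  also have "\<dots> \<le> 0"
    using integral_le_T T_eq_integral by (metis diff_le_0_iff_le)
  finally show ?thesis .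
qed

lemma P_diff: "P \<psi> - P \<phi> = (R \<psi> - R \<phi>) *\<^sub>R dirv \<psi> + R \<phi> *\<^sub>R (dirv \<psi> - dirv \<phi>)"
  by (simp add: P_def algebra_simps)

text \<open>The subgradient inequality at \<phi> gives this upper bound; the one at \<psi>, with the
  roles exchanged, gives the lower bound below. They differ only in the point at which
  \<open>V\<close> is taken.\<close>

lemma R_diff_upper: "(R \<psi> - R \<phi>) * (dirv \<psi> \<bullet> V \<phi>) \<le> - R \<phi> * ((dirv \<psi> - dirv \<phi>) \<bullet> V \<phi>)"
  using P_diff_inner_V[of \<psi> \<phi>] by (simp add: P_diff inner_add_left)

lemma R_diff_lower: "- R \<phi> * ((dirv \<psi> - dirv \<phi>) \<bullet> V \<psi>) \<le> (R \<psi> - R \<phi>) * (dirv \<psi> \<bullet> V \<psi>)"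
proof -
  have "0 \<le> (P \<psi> - P \<phi>) \<bullet> V \<psi>"
    using P_diff_inner_V[of \<phi> \<psi>] by (simp add: inner_diff_left)
  then show ?thesis by (simp add: P_diff inner_add_left)
qed

text \<open>Uses only bounds on \<open>V\<close>, no continuity of it, and so gets the bootstrap
  started. The constant collects \<open>R \<phi> \<le> bound\<close>,
  \<open>norm (V \<psi>) \<le> 2\<close> and
  \<open>1 \<le> dirv \<psi> \<bullet> V \<psi>\<close>.\<close>

lemma R_lipschitz: "\<bar>R \<psi> - R \<phi>\<bar> \<le> 2 * bound * \<bar>\<psi> - \<phi>\<bar>"
proof -
  have *: "R \<phi> - R \<psi> \<le> 2 * bound * \<bar>\<psi> - \<phi>\<bar>" for \<phi> \<psi>
  proof (cases "R \<phi> \<le> R \<psi>")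
    case True
    then show ?thesis
      using mult_nonneg_nonneg[OF order_trans[OF R_nonneg R_le_bound] abs_ge_zero, of "\<psi> - \<phi>"]
      by simp
  next
    case False
    then have "(R \<phi> - R \<psi>) * 1 \<le> (R \<phi> - R \<psi>) * (dirv \<psi> \<bullet> V \<psi>)"
      using inner_dirv_V_ge by (intro mult_left_mono) auto
    also have "\<dots> \<le> R \<phi> * ((dirv \<psi> - dirv \<phi>) \<bullet> V \<psi>)"
      using R_diff_lower[of \<phi> \<psi>] by (simp add: algebra_simps)
    also have "\<dots> \<le> R \<phi> * (\<bar>\<psi> - \<phi>\<bar> * 2)"
    proof (rule mult_left_mono[OF _ R_nonneg])
      have "(dirv \<psi> - dirv \<phi>) \<bullet> V \<psi> \<le> norm (dirv \<psi> - dirv \<phi>) * norm (V \<psi>)"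
        by (rule norm_cauchy_schwarz)
      also have "\<dots> \<le> \<bar>\<psi> - \<phi>\<bar> * 2"
        by (intro mult_mono norm_dirv_diff_le norm_V) auto
      finally show "(dirv \<psi> - dirv \<phi>) \<bullet> V \<psi> \<le> \<bar>\<psi> - \<phi>\<bar> * 2" .
    qed
    also have "\<dots> \<le> bound * (\<bar>\<psi> - \<phi>\<bar> * 2)"
      using R_le_bound by (intro mult_right_mono) auto
    finally show ?thesis by (simp add: mult.commute mult.left_commute)
  qed
  show ?thesis
    using *[of \<psi> \<phi>] *[of \<phi> \<psi>] by (simp add: abs_le_iff abs_minus_commute)
qed

lemma R_cont: "continuous_on S R"
proof -
  have "0 \<le> bound" using order_trans[OF R_nonneg R_le_bound] .
  then have "(2 * bound)-lipschitz_on UNIV R"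
    by (intro lipschitz_onI) (auto simp: dist_real_def R_lipschitz)
  then show ?thesis
    using lipschitz_on_continuous_on continuous_on_subset by blast
qed

text \<open>The tangency equation is closed and determines the angle uniquely in a compact interval,
  so the graph is closed.\<close>

lemma B_cont:
  assumes \<sigma>: "\<sigma> = 1 \<or> \<sigma> = -1"
  shows "continuous_on UNIV (B \<sigma>)"
proof (rule continuous_from_closed_graph[of "{0..pi / 2}"])
  show "B \<sigma> \<in> UNIV \<rightarrow> {0..pi / 2}"
    using B_props(1,2)[OF \<sigma>] by simp
  have "(\<lambda>\<phi>. (\<phi>, B \<sigma> \<phi>)) ` UNIV =
      {z. (0 \<le> snd z \<and> snd z \<le> pi / 2) \<and> h (fst z + \<sigma> * snd z) = R (fst z) * cos (snd z)}"
  proof (intro equalityI subsetI)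
    fix z assume "z \<in> {z. (0 \<le> snd z \<and> snd z \<le> pi / 2) \<and> h (fst z + \<sigma> * snd z) = R (fst z) * cos (snd z)}"
    then have "snd z = B \<sigma> (fst z)"
      using B_props(8)[OF \<sigma>] by blast
    then have "z = (fst z, B \<sigma> (fst z))"
      by (simp add: prod_eq_iff)
    then show "z \<in> (\<lambda>\<phi>. (\<phi>, B \<sigma> \<phi>)) ` UNIV" by blast
  qed (use B_props(1-3)[OF \<sigma>] in auto)
  also have "closed \<dots>"
    by (intro closed_Collect_conj closed_Collect_le closed_Collect_eq continuous_on_mult
        continuous_on_const continuous_on_fst continuous_on_snd continuous_on_id continuous_on_cos
        continuous_on_add continuous_on_compose2[OF h_cont[of UNIV]] continuous_on_compose2[OF R_cont[of UNIV]] subset_UNIV)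
  finally show "closed ((\<lambda>\<phi>. (\<phi>, B \<sigma> \<phi>)) ` UNIV)" .
qed simp

lemma A_cont: "continuous_on UNIV A1" "continuous_on UNIV A2"
  unfolding A1_def A2_def by (intro continuous_intros B_cont; simp)+

lemma V_cont: "continuous_on UNIV V"
  unfolding V_def by (intro continuous_intros A_cont)

text \<open>The solution of \<open>R1 \<phi> * (dirv \<phi> \<bullet> V \<phi>) + R \<phi> * (dirv
  (\<phi> + pi / 2) \<bullet> V \<phi>) = 0\<close>, that is, the velocity of the curve is
  orthogonal to the gradient.\<close>

definition R1 :: "real \<Rightarrow> real" where
  "R1 \<phi> = - R \<phi> * (dirv (\<phi> + pi / 2) \<bullet> V \<phi>) / (dirv \<phi> \<bullet> V \<phi>)"

end

text \<open>Implicit differentiation of the tangency equation when \<omega> is known to be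
  continuous and \<open>h\<close> is differentiable at the one angle
  \<open>\<omega> x\<close>.\<close>

lemma DERIV_implicit_angle:
  fixes P :: "real \<Rightarrow> real^2" and h \<omega> :: "real \<Rightarrow> real"
  assumes P: "(P has_vector_derivative P') (at x)" and \<omega>: "isCont \<omega> x"
    and h: "(h has_real_derivative d) (at (\<omega> x))"
    and eq: "\<And>y. h (\<omega> y) = P y \<bullet> dirv (\<omega> y)"
    and ne: "d - P x \<bullet> dirv (\<omega> x + pi / 2) \<noteq> 0"
  shows "(\<omega> has_real_derivative (P' \<bullet> dirv (\<omega> x)) / (d - P x \<bullet> dirv (\<omega> x + pi / 2))) (at x)"
proof -
  let ?D = "d - P x \<bullet> dirv (\<omega> x + pi / 2)"
  have "((\<lambda>s. P x \<bullet> dirv s) has_real_derivative P x \<bullet> dirv (\<omega> x + pi / 2)) (at (\<omega> x))"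
    unfolding has_real_derivative_iff_has_vector_derivative
    by (rule bounded_linear.has_vector_derivative[OF bounded_linear_inner_right has_vector_derivative_dirv])
  then have "((\<lambda>s. h s - P x \<bullet> dirv s) has_real_derivative ?D) (at (\<omega> x))"
    by (rule DERIV_diff[OF h])
  \<comment> \<open>The difference quotient \<open>q\<close> of the tangency function at the fixed
    point \<open>P x\<close>. Inserting \<open>\<omega> y\<close> and the equation at
    \<open>y\<close> turns its left side into
    \<open>(P y - P x) \<bullet> dirv (\<omega> y)\<close>, which can be solved for
    \<open>\<omega> y - \<omega> x\<close>.\<close>
  then obtain q where q: "\<And>s. (h s - P x \<bullet> dirv s) - (h (\<omega> x) - P x \<bullet> dirv (\<omega> x)) = q s * (s - \<omega> x)"
    "isCont q (\<omega> x)" "q (\<omega> x) = ?D"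
    unfolding CARAT_DERIV by blast
  have qc: "isCont (\<lambda>y. q (\<omega> y)) x"
    using isCont_o2[OF \<omega> q(2)] .
  have "isCont (\<lambda>s. dirv s) (\<omega> x)"
    by (rule has_vector_derivative_continuous[OF has_vector_derivative_dirv])
  then have "isCont (\<lambda>y. dirv (\<omega> y)) x"
    using isCont_o2[OF \<omega>] by blast
  moreover have "((\<lambda>y. P y - P x) has_vector_derivative P') (at x)"
    using has_vector_derivative_diff[OF P has_vector_derivative_const] by simp
  ultimately have "((\<lambda>y. (P y - P x) \<bullet> dirv (\<omega> y)) has_real_derivative P' \<bullet> dirv (\<omega> x)) (at x)"
    by (intro DERIV_inner_vanishing) simp_all
  then have deriv: "((\<lambda>y. (P y - P x) \<bullet> dirv (\<omega> y) * inverse (q (\<omega> y))) has_real_derivative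
      P' \<bullet> dirv (\<omega> x) * inverse (q (\<omega> x))) (at x)"
    using qc ne q(3) by (intro DERIV_mult_vanishing continuous_at_within_inverse) simp_all
  have ev: "\<forall>\<^sub>F y in nhds x. (P y - P x) \<bullet> dirv (\<omega> y) * inverse (q (\<omega> y)) = \<omega> y - \<omega> x"
  proof -
    have "\<forall>\<^sub>F y in at x. q (\<omega> y) \<noteq> 0"
      using qc ne q(3) by (intro tendsto_imp_eventually_ne[of _ "q (\<omega> x)"]) (simp_all add: isCont_def)
    then have "\<forall>\<^sub>F y in nhds x. q (\<omega> y) \<noteq> 0"
      unfolding eventually_at_filter
      by eventually_elim (use ne q(3) in auto)
    then show ?thesis
    proof eventually_elim
      case (elim y)
      have "(P y - P x) \<bullet> dirv (\<omega> y) = q (\<omega> y) * (\<omega> y - \<omega> x)"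
        using q(1)[of "\<omega> y"] eq[of y] eq[of x] by (simp add: inner_diff_left)
      then show ?case using elim by simp
    qed
  qed
  have "((\<lambda>y. \<omega> y - \<omega> x) has_real_derivative P' \<bullet> dirv (\<omega> x) * inverse (q (\<omega> x))) (at x)"
    by (rule iffD1[OF DERIV_cong_ev[OF refl ev refl] deriv])
  from DERIV_add[OF this DERIV_const[of "\<omega> x"]] show ?thesis
    by (simp only: q(3) divide_inverse diff_add_cancel add_0_right)
qed

context long_string
begin

text \<open>The radius is squeezed between the two subgradient bounds. The lower one contains
  \<open>V \<psi>\<close>, which is only continuous so far; it is multiplied by
  \<open>dirv \<psi> - dirv \<phi>\<close>, which vanishes at \<phi>.\<close>

lemma R_deriv: "(R has_real_derivative R1 \<phi>) (at \<phi>)"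
proof -
  let ?u' = "dirv (\<phi> + pi / 2)"
  have Vc: "isCont V \<phi>" and dc: "isCont dirv \<phi>"
    using V_cont by (auto simp: continuous_on_eq_continuous_at
        intro: has_vector_derivative_continuous[OF has_vector_derivative_dirv])
  have pos: "dirv \<phi> \<bullet> V \<phi> \<noteq> 0" using inner_dirv_V_ge[of \<phi>] by linarith
  have diff: "((\<lambda>\<psi>. dirv \<psi> - dirv \<phi>) has_vector_derivative ?u') (at \<phi>)"
    using has_vector_derivative_diff[OF has_vector_derivative_dirv has_vector_derivative_const] by simp
  have scale: "- a * (v \<bullet> (inverse k *\<^sub>R w)) = - a * (v \<bullet> w) / k" for a k :: real and v w :: "real^2"
    by (simp only: inner_scaleR_right divide_inverse mult_ac)
  \<comment> \<open>\<open>W\<close> stands for \<open>V\<close> in the lower bound and for the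
    constant \<open>V \<phi>\<close> in the upper one.\<close>
  have step: "((\<lambda>\<psi>. R \<phi> + - R \<phi> * ((dirv \<psi> - dirv \<phi>) \<bullet> (inverse (dirv \<psi> \<bullet> W \<psi>) *\<^sub>R W \<psi>)))
      has_real_derivative R1 \<phi>) (at \<phi>)" if W: "isCont W \<phi>" "W \<phi> = V \<phi>" for W
  proof -
    have "isCont (\<lambda>\<psi>. inverse (dirv \<psi> \<bullet> W \<psi>) *\<^sub>R W \<psi>) \<phi>"
      using W dc pos by (intro continuous_intros) auto
    from DERIV_inner_vanishing[OF diff _ this]
    have "((\<lambda>\<psi>. (dirv \<psi> - dirv \<phi>) \<bullet> (inverse (dirv \<psi> \<bullet> W \<psi>) *\<^sub>R W \<psi>)) has_real_derivative
        ?u' \<bullet> (inverse (dirv \<phi> \<bullet> W \<phi>) *\<^sub>R W \<phi>)) (at \<phi>)" by simp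
    from DERIV_add[OF DERIV_const[of "R \<phi>"] DERIV_cmult[OF this, of "- R \<phi>"]]
    show ?thesis by (simp only: W(2) R1_def scale add_0_left)
  qed
  \<comment> \<open>The upper bound divides by \<open>dirv \<psi> \<bullet> V \<phi>\<close> with
    mixed arguments, whose positivity is ensured only for \<psi> near \<phi>.\<close>
  have "isCont (\<lambda>\<psi>. dirv \<psi> \<bullet> V \<phi>) \<phi>" using dc by (intro continuous_intros)
  then have ev: "\<forall>\<^sub>F \<psi> in at \<phi>. 0 < dirv \<psi> \<bullet> V \<phi>"
    using inner_dirv_V_ge[of \<phi>] by (intro order_tendstoD(1)[of _ "dirv \<phi> \<bullet> V \<phi>"]) (auto simp: isCont_def)
  show ?thesis
  proof (rule DERIV_squeeze[OF step[OF Vc refl] step[OF continuous_const refl]])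
    show "\<forall>\<^sub>F \<psi> in at \<phi>.
        R \<phi> + - R \<phi> * ((dirv \<psi> - dirv \<phi>) \<bullet> (inverse (dirv \<psi> \<bullet> V \<psi>) *\<^sub>R V \<psi>)) \<le> R \<psi> \<and>
        R \<psi> \<le> R \<phi> + - R \<phi> * ((dirv \<psi> - dirv \<phi>) \<bullet> (inverse (dirv \<psi> \<bullet> V \<phi>) *\<^sub>R V \<phi>))"
      using ev
    proof eventually_elim
      case (elim \<psi>)
      have pos: "0 < dirv \<psi> \<bullet> V \<psi>" using inner_dirv_V_ge[of \<psi>] by linarith
      have "- R \<phi> * ((dirv \<psi> - dirv \<phi>) \<bullet> V \<psi>) / (dirv \<psi> \<bullet> V \<psi>) \<le> R \<psi> - R \<phi>"
        using R_diff_lower[of \<phi> \<psi>] by (simp only: pos_divide_le_eq[OF pos])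
      moreover have "R \<psi> - R \<phi> \<le> - R \<phi> * ((dirv \<psi> - dirv \<phi>) \<bullet> V \<phi>) / (dirv \<psi> \<bullet> V \<phi>)"
        using R_diff_upper[of \<psi> \<phi>] by (simp only: pos_le_divide_eq[OF elim])
      ultimately show ?case
        unfolding scale by linarith
    qed
  qed simp_all
qed

section \<open>Derivatives of the tangent directions and second derivative of the radius\<close>

definition P1 :: "real \<Rightarrow> real^2" where
  "P1 \<phi> = R1 \<phi> *\<^sub>R dirv \<phi> + R \<phi> *\<^sub>R dirv (\<phi> + pi / 2)"

lemma P_deriv: "(P has_vector_derivative P1 \<phi>) (at \<phi>)"
  unfolding P_def P1_def
  using has_vector_derivative_scaleR[OF R_deriv has_vector_derivative_dirv] by (simp add: add.commute)

definition dA :: "real \<Rightarrow> real \<Rightarrow> real" where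
  "dA \<sigma> \<phi> = (P1 \<phi> \<bullet> dirv (\<phi> + \<sigma> * B \<sigma> \<phi>)) / (h' (\<phi> + \<sigma> * B \<sigma> \<phi>) + \<sigma> * (R \<phi> * sin (B \<sigma> \<phi>)))"

text \<open>Transversality: the second summand has absolute value above \<open>M\<close>, the first
  at most \<open>M\<close>.\<close>

lemma dA_denom:
  assumes \<sigma>: "\<sigma> = 1 \<or> \<sigma> = -1"
  shows "h' (\<phi> + \<sigma> * B \<sigma> \<phi>) + \<sigma> * (R \<phi> * sin (B \<sigma> \<phi>)) \<noteq> 0"
  using B_props(4)[OF \<sigma>, of \<phi>] h'_le[of "\<phi> + \<sigma> * B \<sigma> \<phi>"] \<sigma> by auto

lemma A_deriv:
  assumes \<sigma>: "\<sigma> = 1 \<or> \<sigma> = -1"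
  shows "((\<lambda>\<phi>. \<phi> + \<sigma> * B \<sigma> \<phi>) has_real_derivative dA \<sigma> \<phi>) (at \<phi>)"
proof -
  have *: "P \<phi> \<bullet> dirv (\<phi> + \<sigma> * B \<sigma> \<phi>) = R \<phi> * cos (B \<sigma> \<phi>)"
    "- (P \<phi> \<bullet> dirv (\<phi> + \<sigma> * B \<sigma> \<phi> + pi / 2)) = \<sigma> * (R \<phi> * sin (B \<sigma> \<phi>))" for \<phi>
    using \<sigma> by (auto simp: P_def inner_dirv_dirv cos_add cos_diff sin_add sin_diff)
  have cont: "isCont (\<lambda>\<phi>. \<phi> + \<sigma> * B \<sigma> \<phi>) \<phi>"
    using B_cont[OF \<sigma>] by (intro continuous_intros) (simp add: continuous_on_eq_continuous_at)
  have den: "h' (\<phi> + \<sigma> * B \<sigma> \<phi>) - P \<phi> \<bullet> dirv (\<phi> + \<sigma> * B \<sigma> \<phi> + pi / 2) =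
      h' (\<phi> + \<sigma> * B \<sigma> \<phi>) + \<sigma> * (R \<phi> * sin (B \<sigma> \<phi>))"
    using *(2)[of \<phi>] by simp
  have eq: "h (y + \<sigma> * B \<sigma> y) = P y \<bullet> dirv (y + \<sigma> * B \<sigma> y)" for y
    by (simp only: *(1) B_props(3)[OF \<sigma>])
  have ne: "h' (\<phi> + \<sigma> * B \<sigma> \<phi>) - P \<phi> \<bullet> dirv (\<phi> + \<sigma> * B \<sigma> \<phi> + pi / 2) \<noteq> 0"
    unfolding den by (rule dA_denom[OF \<sigma>])
  show ?thesis
    using DERIV_implicit_angle[where \<omega> = "\<lambda>\<phi>. \<phi> + \<sigma> * B \<sigma> \<phi>", OF P_deriv cont h_deriv eq ne]
    unfolding den dA_def .
qed

definition V1 :: "real \<Rightarrow> real^2" where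
  "V1 \<phi> = dA 1 \<phi> *\<^sub>R dirv (A2 \<phi>) - dA (- 1) \<phi> *\<^sub>R dirv (A1 \<phi>)"

lemma V_deriv: "(V has_vector_derivative V1 \<phi>) (at \<phi>)"
proof -
  have *: "((\<lambda>\<phi>. dirv ((\<phi> + \<sigma> * B \<sigma> \<phi>) - pi / 2)) has_vector_derivative dA \<sigma> \<phi> *\<^sub>R dirv (\<phi> + \<sigma> * B \<sigma> \<phi>)) (at \<phi>)"
    if "\<sigma> = 1 \<or> \<sigma> = -1" for \<sigma>
    using has_vector_derivative_dirv_compose[OF DERIV_diff[OF A_deriv[OF that] DERIV_const[of "pi / 2"]]]
    by simp
  show ?thesis
    unfolding V_def V1_def A1_def A2_def
    by (intro has_vector_derivative_diff *) auto
qed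

text \<open>The quotient rule for \<open>R1\<close>, left unsimplified in the shape in which
  \<open>DERIV_divide\<close> delivers it.\<close>

definition R2 :: "real \<Rightarrow> real" where
  "R2 \<phi> = ((- R1 \<phi> * (dirv (\<phi> + pi / 2) \<bullet> V \<phi>)
      + - R \<phi> * (dirv (\<phi> + pi / 2) \<bullet> V1 \<phi> - dirv \<phi> \<bullet> V \<phi>)) * (dirv \<phi> \<bullet> V \<phi>)
    - - R \<phi> * (dirv (\<phi> + pi / 2) \<bullet> V \<phi>) * (dirv \<phi> \<bullet> V1 \<phi> + dirv (\<phi> + pi / 2) \<bullet> V \<phi>))
    / ((dirv \<phi> \<bullet> V \<phi>) * (dirv \<phi> \<bullet> V \<phi>))"

lemma has_vector_derivative_dirv_perp:
  "((\<lambda>\<phi>. dirv (\<phi> + pi / 2)) has_vector_derivative - dirv \<phi>) (at \<phi>)"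
  using has_vector_derivative_dirv_compose[OF DERIV_add[OF DERIV_ident DERIV_const[of "pi / 2"]], of \<phi>]
  by (simp add: add.assoc dirv_plus_pi)

lemma R1_deriv: "(R1 has_real_derivative R2 \<phi>) (at \<phi>)"
proof -
  have pos: "dirv \<phi> \<bullet> V \<phi> \<noteq> 0" using inner_dirv_V_ge[of \<phi>] by linarith
  note inner = bounded_bilinear.has_vector_derivative[OF bounded_bilinear_inner]
  have D: "((\<lambda>\<phi>. dirv \<phi> \<bullet> V \<phi>) has_real_derivative dirv \<phi> \<bullet> V1 \<phi> + dirv (\<phi> + pi / 2) \<bullet> V \<phi>) (at \<phi>)"
    unfolding has_real_derivative_iff_has_vector_derivative
    by (rule inner[OF has_vector_derivative_dirv V_deriv])
  have N: "((\<lambda>\<phi>. dirv (\<phi> + pi / 2) \<bullet> V \<phi>) has_real_derivative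
      dirv (\<phi> + pi / 2) \<bullet> V1 \<phi> - dirv \<phi> \<bullet> V \<phi>) (at \<phi>)"
    unfolding has_real_derivative_iff_has_vector_derivative
    using inner[OF has_vector_derivative_dirv_perp V_deriv] by simp
  have RN: "((\<lambda>\<phi>. - R \<phi> * (dirv (\<phi> + pi / 2) \<bullet> V \<phi>)) has_real_derivative
      - R1 \<phi> * (dirv (\<phi> + pi / 2) \<bullet> V \<phi>) + - R \<phi> * (dirv (\<phi> + pi / 2) \<bullet> V1 \<phi> - dirv \<phi> \<bullet> V \<phi>)) (at \<phi>)"
    using DERIV_mult'[OF DERIV_minus[OF R_deriv] N] by (simp only: add.commute)
  show ?thesis
    using DERIV_divide[OF RN D pos] unfolding R1_def[abs_def] R2_def .
qed

definition P2 :: "real \<Rightarrow> real^2" where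
  "P2 \<phi> = R2 \<phi> *\<^sub>R dirv \<phi> + (2 * R1 \<phi>) *\<^sub>R dirv (\<phi> + pi / 2) - R \<phi> *\<^sub>R dirv \<phi>"

lemma P1_deriv: "(P1 has_vector_derivative P2 \<phi>) (at \<phi>)"
proof -
  have "(P1 has_vector_derivative (R1 \<phi> *\<^sub>R dirv (\<phi> + pi / 2) + R2 \<phi> *\<^sub>R dirv \<phi>)
      + (R \<phi> *\<^sub>R - dirv \<phi> + R1 \<phi> *\<^sub>R dirv (\<phi> + pi / 2))) (at \<phi>)"
    unfolding P1_def[abs_def]
    by (intro has_vector_derivative_add has_vector_derivative_scaleR R_deriv R1_deriv
        has_vector_derivative_dirv has_vector_derivative_dirv_perp)
  moreover have "(R1 \<phi> *\<^sub>R dirv (\<phi> + pi / 2) + R2 \<phi> *\<^sub>R dirv \<phi>)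
      + (R \<phi> *\<^sub>R - dirv \<phi> + R1 \<phi> *\<^sub>R dirv (\<phi> + pi / 2)) = P2 \<phi>"
    unfolding P2_def vec_eq_iff forall_2
    by (simp only: vector_add_component vector_minus_component vector_scaleR_component
        vector_uminus_component) (simp add: algebra_simps)
  ultimately show ?thesis by simp
qed

lemma P_cont: "continuous_on UNIV P" and P1_cont: "continuous_on UNIV P1"
  using P_deriv P1_deriv has_vector_derivative_continuous by (blast intro: continuous_at_imp_continuous_on)+

lemma R1_cont: "continuous_on UNIV R1"
  using R1_deriv by (blast intro: continuous_at_imp_continuous_on DERIV_isCont)

text \<open>Here the continuity of \<open>h'\<close> enters; through \<open>V1\<close> it becomes
  continuity of the second derivative of the radius.\<close>

lemma dA_cont:
  assumes \<sigma>: "\<sigma> = 1 \<or> \<sigma> = -1"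
  shows "continuous_on UNIV (dA \<sigma>)"
  unfolding dA_def using dA_denom[OF \<sigma>]
  by (intro continuous_on_divide continuous_on_inner P1_cont continuous_on_dirv continuous_on_add
      continuous_on_mult continuous_on_const continuous_on_id B_cont[OF \<sigma>] R_cont continuous_on_sin
      continuous_on_compose2[OF h'_cont] subset_UNIV ballI)

lemma V1_cont: "continuous_on UNIV V1"
  unfolding V1_def by (intro continuous_intros dA_cont A_cont) auto

lemma R2_cont: "continuous_on UNIV R2"
proof -
  have "dirv \<phi> \<bullet> V \<phi> \<noteq> 0" for \<phi> using inner_dirv_V_ge[of \<phi>] by linarith
  then show ?thesis
    unfolding R2_def by (intro continuous_intros V1_cont V_cont R_cont R1_cont) auto
qed

lemma P2_cont: "continuous_on UNIV P2"
  unfolding P2_def by (intro continuous_intros R2_cont R1_cont R_cont)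

lemma level_set_C2: "Ck_closed_curve 2 {Q. excess h Q = T}"
proof -
  define c where "c t = P (2 * pi * t)" for t
  \<comment> \<open>Indices beyond 2 repeat the second derivative as a default; the condition
    \<open>Ck_map 2\<close> speaks of indices up to 2.\<close>
  define D where "D j = (if j = 0 then c else if j = 1 then (\<lambda>t. (2 * pi) *\<^sub>R P1 (2 * pi * t))
    else (\<lambda>t. (2 * pi) *\<^sub>R (2 * pi) *\<^sub>R P2 (2 * pi * t)))" for j :: nat
  have chain: "((\<lambda>t. f (2 * pi * t)) has_vector_derivative (2 * pi) *\<^sub>R f' (2 * pi * t)) (at t)"
    if f: "\<And>x. (f has_vector_derivative f' x) (at x)" for f f' :: "real \<Rightarrow> real^2" and t
  proof -
    have "((\<lambda>t. 2 * pi * t) has_vector_derivative 2 * pi) (at t)"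
      unfolding has_real_derivative_iff_has_vector_derivative[symmetric]
      by (auto intro!: derivative_eq_intros)
    from vector_diff_chain_at[OF this f] show ?thesis by (simp add: o_def)
  qed
  have D1: "(c has_vector_derivative (2 * pi) *\<^sub>R P1 (2 * pi * t)) (at t)" for t
    unfolding c_def by (rule chain[OF P_deriv])
  have D2: "((\<lambda>t. (2 * pi) *\<^sub>R P1 (2 * pi * t)) has_vector_derivative
      (2 * pi) *\<^sub>R (2 * pi) *\<^sub>R P2 (2 * pi * t)) (at t)" for t
    by (intro bounded_linear.has_vector_derivative[OF bounded_linear_scaleR_right] chain[OF P1_deriv])
  have "Ck_map 2 c"
    unfolding Ck_map_def
  proof (intro exI[of _ D] conjI allI impI)
    show "D 0 = c" by (simp add: D_def)
    show "(D j has_vector_derivative D (Suc j) t) (at t)" if "j < 2" for j t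
      using that D1 D2 by (auto simp: D_def less_2_cases_iff)
    have "continuous_on UNIV (\<lambda>t. P (2 * pi * t))" "continuous_on UNIV (\<lambda>t. P1 (2 * pi * t))"
      "continuous_on UNIV (\<lambda>t. P2 (2 * pi * t))"
      by (rule continuous_on_compose2[OF P_cont] continuous_on_compose2[OF P1_cont]
          continuous_on_compose2[OF P2_cont]; auto intro: continuous_intros)+
    then show "continuous_on UNIV (D j)" for j
      unfolding D_def c_def by (auto intro: continuous_on_scaleR continuous_on_const)
  qed
  moreover have per: "R (\<phi> + 2 * pi) = R \<phi>" for \<phi>
    by (simp add: R_def)
  have "c (t + 1) = c t" for t
    using per[of "2 * pi * t"] dirv_periodic[of "2 * pi * t"]
    by (simp add: c_def P_def distrib_left)
  moreover have "inj_on c {0..<1}"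
  proof (rule inj_onI)
    fix s t :: real assume st: "s \<in> {0..<1}" "t \<in> {0..<1}" "c s = c t"
    have "norm (c s) = R (2 * pi * s)" "norm (c t) = R (2 * pi * t)"
      using R_nonneg by (simp_all add: c_def P_def)
    then have "R (2 * pi * s) = R (2 * pi * t)" using st(3) by simp
    then have "dirv (2 * pi * s) = dirv (2 * pi * t)"
      using st(3) R_pos[of "2 * pi * t"] by (simp add: c_def P_def)
    then show "s = t" using inj_onD[OF inj_on_dirv_unit] st(1,2) by blast
  qed
  moreover have "vector_derivative c (at t) \<noteq> 0" for t
  proof
    assume "vector_derivative c (at t) = 0"
    then have "P1 (2 * pi * t) = 0"
      using vector_derivative_at[OF D1[of t]] by simp
    \<comment> \<open>The component of the velocity orthogonal to the radius is \<open>R\<close>,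
      which is positive.\<close>
    then have "P1 (2 * pi * t) \<bullet> dirv (2 * pi * t + pi / 2) = 0" by simp
    then show False
      using R_pos[of "2 * pi * t"] by (simp add: P1_def inner_add_left inner_dirv_perp inner_dirv_dirv)
  qed
  moreover have "range c = {Q. excess h Q = T}"
  proof (intro equalityI subsetI)
    fix Q assume "Q \<in> {Q. excess h Q = T}"
    then have Q: "excess h Q = T" by simp
    obtain t where t: "Q = norm Q *\<^sub>R dirv (2 * pi * t)"
      by (rule polar_real2)
    have "R (2 * pi * t) = norm Q"
      using Q t by (intro R_eqI) auto
    then have "Q = c t" using t by (simp add: c_def P_def)
    then show "Q \<in> range c" by blast
  qed (auto simp: c_def P_def excess_R)
  ultimately show ?thesis
    unfolding Ck_closed_curve_def by blast
qed

end

section \<open>Lenses\<close>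

text \<open>The origin in the interior makes the support function positive and serves as the pole of
  the polar coordinates. Since the derivative of the support function comes from a point of
  \<open>K\<close>, one bound \<open>M\<close> for the norms in \<open>K\<close> controls
  both.\<close>

theorem string_construction_C2:
  fixes K :: "(real^2) set"
  assumes K: "compact K" "strictly_convex K" and 0: "0 \<in> interior K"
  obtains S where "\<exists>L. simple_closed_curve_length (frontier K) L \<and> L < S"
    "Ck_closed_curve 2 (string_construction K S)"
proof -
  have ne: "interior K \<noteq> {}" "K \<noteq> {}" using 0 interior_subset by blast+
  obtain \<gamma> where \<gamma>: "\<And>\<theta>. \<gamma> \<theta> \<in> K" "continuous_on UNIV \<gamma>"
    "\<And>\<theta>. (supp K has_real_derivative \<gamma> \<theta> \<bullet> dirv (\<theta> + pi / 2)) (at \<theta>)"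
    using strictly_convex_supp_deriv[OF K ne(2)] by blast
  obtain M where M: "0 < M" "\<And>x. x \<in> K \<Longrightarrow> norm x \<le> M"
    using K(1) compact_imp_bounded bounded_pos by metis
  obtain e where e: "0 < e" "cball 0 e \<subseteq> K"
    using 0 by (auto simp: mem_interior_cball)
  have inner_le: "\<bar>x \<bullet> dirv \<theta>\<bar> \<le> M" if "x \<in> K" for x \<theta>
    using Cauchy_Schwarz_ineq2[of x "dirv \<theta>"] M(2)[OF that] by simp
  \<comment> \<open>The summand 1 makes the inequality \<open>4 * pi * M < T\<close> strict.\<close>
  define T where "T = 4 * pi * M + 1"
  have T: "0 < T" using M(1) by (simp add: T_def add_pos_pos)
  interpret long_string "supp K" "\<lambda>\<theta>. \<gamma> \<theta> \<bullet> dirv (\<theta> + pi / 2)" M T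
  proof
    fix \<theta>
    show "(supp K has_real_derivative \<gamma> \<theta> \<bullet> dirv (\<theta> + pi / 2)) (at \<theta>)"
      by (rule \<gamma>)
    show "continuous_on UNIV (\<lambda>\<theta>. \<gamma> \<theta> \<bullet> dirv (\<theta> + pi / 2))"
      by (intro continuous_intros \<gamma>)
    have "e *\<^sub>R dirv \<theta> \<in> K" using e by (intro subsetD[OF e(2)]) simp
    from supp_ge[OF K(1) this, of \<theta>] show "0 < supp K \<theta>"
      using e(1) by (simp add: inner_dirv_dirv)
    show "supp K \<theta> \<le> M"
      using inner_le by (intro supp_le ne) (simp add: abs_le_iff)
    show "\<bar>\<gamma> \<theta> \<bullet> dirv (\<theta> + pi / 2)\<bar> \<le> M"
      by (intro inner_le \<gamma>)
  qed (simp_all add: T_def supp_periodic)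
  show ?thesis
  proof
    have "simple_closed_curve_length (frontier K) (perimeter K)"
      using K ne by (simp add: simple_closed_curve_length_frontier_iff strictly_convex_def)
    moreover have "perimeter K < perimeter K + 4 / crofton * T"
      using T crofton_pos by simp
    ultimately show "\<exists>L. simple_closed_curve_length (frontier K) L \<and> L < perimeter K + 4 / crofton * T"
      by blast
    show "Ck_closed_curve 2 (string_construction K (perimeter K + 4 / crofton * T))"
      unfolding string_construction_eq[OF K(1) ne(1)] by (rule level_set_C2)
  qed
qed

(* A differentiable curve through a corner that stays in K has its velocity orthogonal to every
   normal of K there, so the velocity vanishes. *)
lemma corner_not_C1:
  fixes K :: "'a::real_inner set"
  assumes "closed K" and p: "p \<in> frontier K"
    and n: "\<And>x. x \<in> K \<Longrightarrow> (x - p) \<bullet> m \<le> 0" "\<And>x. x \<in> K \<Longrightarrow> (x - p) \<bullet> n \<le> 0"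
    and indep: "\<And>v. v \<bullet> m = 0 \<Longrightarrow> v \<bullet> n = 0 \<Longrightarrow> v = 0"
  shows "\<not> Ck_closed_curve 1 (frontier K)"
proof
  assume "Ck_closed_curve 1 (frontier K)"
  then obtain c where c: "Ck_map 1 c" "\<And>t. vector_derivative c (at t) \<noteq> 0" "range c = frontier K"
    unfolding Ck_closed_curve_def by blast
  obtain D where D: "\<And>t. (c has_vector_derivative D t) (at t)"
    using c(1) unfolding Ck_map_def by (metis less_numeral_extra(1))
  obtain t where t: "p = c t" using c(3) p by blast
  have inK: "c s \<in> K" for s
    using c(3) \<open>closed K\<close> frontier_subset_eq by blast
  have orth: "D t \<bullet> w = 0" if w: "\<And>x. x \<in> K \<Longrightarrow> (x - p) \<bullet> w \<le> 0" for w
  proof -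
    have "((\<lambda>s. (c s - p) \<bullet> w) has_vector_derivative (D t - 0) \<bullet> w) (at t)"
      by (intro bounded_linear.has_vector_derivative[OF bounded_linear_inner_left]
          has_vector_derivative_diff D has_vector_derivative_const)
    then have "((\<lambda>s. (c s - p) \<bullet> w) has_real_derivative D t \<bullet> w) (at t)"
      by (simp add: has_real_derivative_iff_has_vector_derivative)
    then show ?thesis
      \<comment> \<open>The maximum 0 at \<open>t\<close> is global, so any radius serves, here
        1.\<close>
      by (rule DERIV_local_max[of _ _ _ 1]) (use w[OF inK] t in auto)
  qed
  have "D t = 0" using indep[OF orth orth] n by blast
  then show False using c(2)[of t] vector_derivative_at[OF D] by simp
qed

text \<open>For \<open>0 < a < 1\<close> the two boundary circles cross on the vertical axis at
  heights plus and minus \<open>sqrt (1 - a\<^sup>2)\<close>, which are the corners.\<close>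

definition lens :: "real \<Rightarrow> (real^2) set" where
  "lens a = cball (a *\<^sub>R dirv 0) 1 \<inter> cball (- (a *\<^sub>R dirv 0)) 1"

lemma compact_lens: "compact (lens a)"
  unfolding lens_def by (intro compact_Int compact_cball)

text \<open>The midpoint of two distinct points of a closed disc lies in the open disc. Applied to
  both discs, this puts the midpoint of a nondegenerate segment into the interior.\<close>

lemma strictly_convex_lens: "strictly_convex (lens a)"
  unfolding strictly_convex_def
proof (intro conjI allI impI)
  show "convex (lens a)"
    unfolding lens_def by (intro convex_Int convex_cball)
  fix x y assume seg: "closed_segment x y \<subseteq> frontier (lens a)"
  show "x = y"
  proof (rule ccontr)
    assume "x \<noteq> y"
    let ?m = "midpoint x y"
    have m: "?m \<in> open_segment x y" using \<open>x \<noteq> y\<close> by simp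
    have "?m \<in> ball c 1" if "x \<in> cball c 1" "y \<in> cball c 1" for c
      using dist_decreases_open_segment[OF m, of c] that by auto
    moreover have "x \<in> lens a" "y \<in> lens a"
      using seg compact_lens[of a] frontier_subset_eq[of "lens a"] ends_in_segment
      by (auto dest: compact_imp_closed)
    ultimately have "?m \<in> ball (a *\<^sub>R dirv 0) 1 \<inter> ball (- (a *\<^sub>R dirv 0)) 1"
      by (simp add: lens_def)
    also have "\<dots> \<subseteq> interior (lens a)"
      unfolding lens_def by (intro interior_maximal) auto
    finally have "?m \<in> interior (lens a)" .
    moreover have "?m \<in> frontier (lens a)"
      using seg by (rule subsetD) simp
    ultimately show False by (simp add: frontier_def)
  qed
qed

lemma zero_in_interior_lens:
  assumes "0 < a" "a < 1"
  shows "0 \<in> interior (lens a)"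
proof -
  have "0 \<in> ball (a *\<^sub>R dirv 0) 1 \<inter> ball (- (a *\<^sub>R dirv 0)) 1"
    using assms by (simp add: dist_norm)
  also have "\<dots> \<subseteq> interior (lens a)"
    unfolding lens_def by (intro interior_maximal) auto
  finally show ?thesis .
qed

lemma inj_on_lens: "inj_on lens {0<..<1}"
proof -
  have le: "b \<le> a" if ab: "0 < a" "a < 1" "0 < b" "lens a = lens b" for a b
  proof -
    have "\<bar>2 * a - 1\<bar> \<le> 1" using ab by auto
    \<comment> \<open>\<open>(1 - a) *\<^sub>R dirv 0\<close> is the rightmost point of
      \<open>lens a\<close>; its membership in \<open>lens b\<close> forces
      \<open>1 - a \<le> 1 - b\<close>.\<close>
    then have "norm (a *\<^sub>R dirv 0 - (1 - a) *\<^sub>R dirv 0) \<le> 1"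
      by (simp flip: scaleR_diff_left)
    moreover have "norm (- (a *\<^sub>R dirv 0) - (1 - a) *\<^sub>R dirv 0) \<le> 1"
      by (simp flip: scaleR_diff_left scaleR_minus_left)
    ultimately have "(1 - a) *\<^sub>R dirv 0 \<in> lens b"
      unfolding ab(4)[symmetric] by (simp add: lens_def dist_norm)
    then have "norm (- (b *\<^sub>R dirv 0) - (1 - a) *\<^sub>R dirv 0) \<le> 1"
      by (simp add: lens_def dist_norm)
    then have "\<bar>- b - (1 - a)\<bar> \<le> 1"
      by (simp flip: scaleR_diff_left scaleR_minus_left)
    then show "b \<le> a" using ab by linarith
  qed
  show ?thesis
    by (rule inj_onI) (use le in \<open>force intro: antisym\<close>)
qed

text \<open>The tangent at a boundary point of a disc is a support line whose outer normal is the
  radius vector.\<close>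

lemma cball_supporting:
  fixes c p :: "'a::real_inner"
  assumes "x \<in> cball c 1" "norm (p - c) = 1"
  shows "(x - p) \<bullet> (p - c) \<le> 0"
proof -
  have "(x - p) \<bullet> (p - c) = (x - c) \<bullet> (p - c) - (p - c) \<bullet> (p - c)"
    by (simp add: inner_diff_left)
  also have "(p - c) \<bullet> (p - c) = 1"
    using assms(2) by (simp add: norm_eq_1)
  also have "(x - c) \<bullet> (p - c) \<le> norm (x - c) * norm (p - c)"
    by (rule norm_cauchy_schwarz)
  finally show ?thesis
    using assms by (simp add: dist_norm norm_minus_commute)
qed

lemma lens_not_C1:
  assumes a: "0 < a" "a < 1"
  shows "\<not> Ck_closed_curve 1 (frontier (lens a))"
proof -
  \<comment> \<open>By Pythagoras, the height at which a point of the vertical axis has distance 1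
    from both centres.\<close>
  define q where "q = sqrt (1 - a\<^sup>2)"
  have "a\<^sup>2 < 1" using a by (simp add: power_less_one_iff abs_square_less_1)
  then have q: "0 < q" "q\<^sup>2 = 1 - a\<^sup>2" by (simp_all add: q_def)
  define p where "p = q *\<^sub>R dirv (pi / 2)"
  have norm1: "norm (p - s *\<^sub>R dirv 0) = 1" if "s\<^sup>2 = a\<^sup>2" for s
    using that q by (simp add: norm_eq_1 p_def inner_real2 power2_eq_square)
  have np: "norm (p - a *\<^sub>R dirv 0) = 1" "norm (p - - (a *\<^sub>R dirv 0)) = 1"
    using norm1[of a] norm1[of "- a"] by simp_all
  have "p \<in> lens a"
    using np by (simp add: lens_def dist_norm norm_minus_commute)
  moreover have "p \<notin> interior (lens a)"
  proof
    assume "p \<in> interior (lens a)"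
    then have "p \<in> interior (cball (a *\<^sub>R dirv 0) 1)"
      by (rule subsetD[OF interior_mono, rotated]) (simp add: lens_def)
    then show False using np(1) by (simp add: dist_norm norm_minus_commute)
  qed
  ultimately have p: "p \<in> frontier (lens a)"
    using compact_lens by (simp add: frontier_def compact_imp_closed)
  show ?thesis
  proof (rule corner_not_C1[OF _ p])
    show "closed (lens a)" using compact_lens by (rule compact_imp_closed)
    show "(x - p) \<bullet> (p - a *\<^sub>R dirv 0) \<le> 0" if "x \<in> lens a" for x
      using that by (intro cball_supporting np) (simp add: lens_def)
    show "(x - p) \<bullet> (p - - (a *\<^sub>R dirv 0)) \<le> 0" if "x \<in> lens a" for x
      using that by (intro cball_supporting np) (simp add: lens_def)
    \<comment> \<open>The outer normals of the two discs at \<open>p\<close> have the coordinates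
      \<open>(- a, q)\<close> and \<open>(a, q)\<close>, which are independent as \<open>a\<close>
      and \<open>q\<close> are nonzero.\<close>
    show "v = 0" if "v \<bullet> (p - a *\<^sub>R dirv 0) = 0" "v \<bullet> (p - - (a *\<^sub>R dirv 0)) = 0" for v
    proof -
      have "v $ 2 * q - v $ 1 * a = 0" "v $ 2 * q + v $ 1 * a = 0"
        using that by (simp_all add: p_def inner_real2)
      then have "v $ 2 * q = 0" "v $ 1 * a = 0" by linarith+
      then show ?thesis
        using q(1) a(1) by (simp add: vec_eq_iff forall_2)
    qed
  qed
qed

theorem theorem3:
  shows "\<exists>(I :: real set) (K :: real \<Rightarrow> (real^2) set) (S :: real \<Rightarrow> real).
           open I \<and> is_interval I \<and> I \<noteq> {} \<and> inj_on K I \<and>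
           (\<forall>\<alpha>\<in>I. compact (K \<alpha>) \<and> strictly_convex (K \<alpha>) \<and>
              (\<exists>L. simple_closed_curve_length (frontier (K \<alpha>)) L \<and> L < S \<alpha>) \<and>
              \<not> Ck_closed_curve 1 (frontier (K \<alpha>)) \<and>
              Ck_closed_curve 2 (string_construction (K \<alpha>) (S \<alpha>)))"
proof -
  have "\<exists>S. (\<exists>L. simple_closed_curve_length (frontier (lens \<alpha>)) L \<and> L < S) \<and>
      Ck_closed_curve 2 (string_construction (lens \<alpha>) S)" if "\<alpha> \<in> {0<..<1}" for \<alpha>
  proof -
    have "0 \<in> interior (lens \<alpha>)" using that by (intro zero_in_interior_lens) auto
    from string_construction_C2[OF compact_lens strictly_convex_lens this] show ?thesis
      by blast
  qed
  then obtain S where S: "\<And>\<alpha>. \<alpha> \<in> {0<..<1} \<Longrightarrow>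
      (\<exists>L. simple_closed_curve_length (frontier (lens \<alpha>)) L \<and> L < S \<alpha>) \<and>
      Ck_closed_curve 2 (string_construction (lens \<alpha>) (S \<alpha>))"
    by metis
  show ?thesis
  proof (intro exI[of _ "{0<..<1::real}"] exI[of _ lens] exI[of _ S] conjI ballI)
    fix \<alpha> :: real assume \<alpha>: "\<alpha> \<in> {0<..<1}"
    show "\<not> Ck_closed_curve 1 (frontier (lens \<alpha>))"
      using \<alpha> by (intro lens_not_C1) auto
  qed (use S in \<open>auto simp: inj_on_lens compact_lens strictly_convex_lens is_interval_oo\<close>)
qed

end
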